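(* Let $A\,|\,B\,|\,C$ be a tower of rings, let $V=A^C$ be the centralizer of $C$ in $A$ and $P=(A\otimes_B A)^C$. Then the tower $A\,|\,B\,|\,C$ is right depth three if and only if the left $V$-module ${}_VP$ is finitely generated projective and $A\otimes_V P\cong A\otimes_B A$ as natural $A$-$C$-bimodules.
   Context: Rings have identity; a tower of rings $A\,|\,B\,|\,C$ is a pair of unital ring homomorphisms $C\to B\to A$, inducing natural bimodule structures. The tower is right depth three if for some positive integer $N$ the bimodule $A\otimes_B A$ is isomorphic, as an $A$-$C$-bimodule, to a direct summand of $A^N$. $V=A^C=\{a\in A: ac=ca\ \forall c\in C\}$ and $P=(A\otimes_B A)^C=\{p\in A\otimes_B A: cp=pc\ \forall c\in C\}$ (elements of $C$ acting through $C\to A$). $P$ is a left $V$-module by left multiplication on the first tensor factor: $v\cdot p=vp^1\otimes_B p^2$, where $p=p^1\otimes_B p^2$ denotes a possibly suppressed finite sum of simple tensors. In $A\otimes_V P$, $A$ is a right $V$-module by multiplication; its natural $A$-$C$-bimodule structure comes from that of ${}_AA_C$: $a'(a\otimes p)c=a'ac\otimes p$. *)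

theory Defs
  imports
    "HOL-Algebra.Module"
    "HOL-Algebra.AbelCoset"
    "HOL-Algebra.Generated_Groups"
    "HOL-Algebra.Free_Abelian_Groups"
begin

text \<open>
  The locale \<^locale>\<open>module\<close> of the library requires a commutative ring of scalars, so only its record
  \<^typ>\<open>('r, 'm) module\<close> is used for left modules over an arbitrary ring; a bimodule is such a record
  with an additional right action. Modules make no use of the fields \<^const>\<open>monoid.mult\<close> and \<^const>\<open>one\<close>
  which the record inherits from rings; where a module is constructed below they are left undefined.
\<close>

record ('r, 's, 'm) bimod = "('r, 'm) module" +
  rsmult :: "'m \<Rightarrow> 's \<Rightarrow> 'm"

definition left_mod_iso ::
  "('r, 'a) ring_scheme \<Rightarrow> ('r, 'm, 'e) module_scheme \<Rightarrow> ('r, 'n, 'f) module_scheme \<Rightarrow> ('m \<Rightarrow> 'n) set"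
  where
  "left_mod_iso R M N =
     {h. bij_betw h (carrier M) (carrier N)
       \<and> (\<forall>x\<in>carrier M. \<forall>y\<in>carrier M. h (x \<oplus>\<^bsub>M\<^esub> y) = h x \<oplus>\<^bsub>N\<^esub> h y)
       \<and> (\<forall>r\<in>carrier R. \<forall>x\<in>carrier M. h (r \<odot>\<^bsub>M\<^esub> x) = r \<odot>\<^bsub>N\<^esub> h x)}"

definition bimod_iso ::
  "('r, 'a) ring_scheme \<Rightarrow> ('s, 'b) ring_scheme \<Rightarrow> ('r, 's, 'm) bimod \<Rightarrow> ('r, 's, 'n) bimod
    \<Rightarrow> ('m \<Rightarrow> 'n) set"
  where
  "bimod_iso R S M N =
     {h \<in> left_mod_iso R M N. \<forall>x\<in>carrier M. \<forall>s\<in>carrier S. h (rsmult M x s) = rsmult N (h x) s}"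

definition sub_bimod ::
  "('r, 'a) ring_scheme \<Rightarrow> ('s, 'b) ring_scheme \<Rightarrow> 'm set \<Rightarrow> ('r, 's, 'm) bimod \<Rightarrow> bool"
  where
  "sub_bimod R S H M \<longleftrightarrow> submodule H R M \<and> (\<forall>x\<in>H. \<forall>s\<in>carrier S. rsmult M x s \<in> H)"

definition direct_summand :: "('r, 'a) ring_scheme \<Rightarrow> 'm set \<Rightarrow> ('r, 'm, 'e) module_scheme \<Rightarrow> bool"
  where
  "direct_summand R D M \<longleftrightarrow>
     submodule D R M \<and>
     (\<exists>L. submodule L R M \<and> D \<inter> L = {\<zero>\<^bsub>M\<^esub>} \<and> D <+>\<^bsub>M\<^esub> L = carrier M)"

definition bimod_direct_summand ::
  "('r, 'a) ring_scheme \<Rightarrow> ('s, 'b) ring_scheme \<Rightarrow> 'm set \<Rightarrow> ('r, 's, 'm) bimod \<Rightarrow> bool"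
  where
  "bimod_direct_summand R S D M \<longleftrightarrow>
     sub_bimod R S D M \<and>
     (\<exists>L. sub_bimod R S L M \<and> D \<inter> L = {\<zero>\<^bsub>M\<^esub>} \<and> D <+>\<^bsub>M\<^esub> L = carrier M)"

definition bimod_power :: "nat \<Rightarrow> ('r, 's, 'm) bimod \<Rightarrow> ('r, 's, nat \<Rightarrow> 'm) bimod"
  where
  "bimod_power N M =
     \<lparr> carrier = {..<N} \<rightarrow>\<^sub>E carrier M, monoid.mult = undefined, one = undefined,
       ring.zero = (\<lambda>i\<in>{..<N}. \<zero>\<^bsub>M\<^esub>),
       add = (\<lambda>x y. \<lambda>i\<in>{..<N}. x i \<oplus>\<^bsub>M\<^esub> y i),
       smult = (\<lambda>r x. \<lambda>i\<in>{..<N}. r \<odot>\<^bsub>M\<^esub> x i),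
       rsmult = (\<lambda>x s. \<lambda>i\<in>{..<N}. rsmult M (x i) s) \<rparr>"

definition finitely_generated_module :: "('r, 'a) ring_scheme \<Rightarrow> ('r, 'm, 'e) module_scheme \<Rightarrow> bool"
  where
  "finitely_generated_module R M \<longleftrightarrow>
     (\<exists>X. finite X \<and> X \<subseteq> carrier M \<and>
        (\<forall>m\<in>carrier M. \<exists>r \<in> X \<rightarrow> carrier R. m = (\<Oplus>\<^bsub>M\<^esub>x\<in>X. r x \<odot>\<^bsub>M\<^esub> x)))"

definition free_module :: "('r, 'a) ring_scheme \<Rightarrow> 'i set \<Rightarrow> ('r, 'i \<Rightarrow> 'r) module"
  where
  "free_module R I =
     \<lparr> carrier = {x \<in> I \<rightarrow>\<^sub>E carrier R. finite {i \<in> I. x i \<noteq> \<zero>\<^bsub>R\<^esub>}}, monoid.mult = undefined, one = undefined,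
       ring.zero = (\<lambda>i\<in>I. \<zero>\<^bsub>R\<^esub>),
       add = (\<lambda>x y. \<lambda>i\<in>I. x i \<oplus>\<^bsub>R\<^esub> y i),
       smult = (\<lambda>r x. \<lambda>i\<in>I. r \<otimes>\<^bsub>R\<^esub> x i) \<rparr>"

text \<open>
  Projective means isomorphic to a direct summand of a free module. Taking the basis from the element
  type of the module is no restriction: a direct summand of any free module is also one of the free
  module on its own underlying set, since the canonical surjection from the latter splits.
\<close>

definition projective_module :: "('r, 'a) ring_scheme \<Rightarrow> ('r, 'm, 'e) module_scheme \<Rightarrow> bool"
  where
  "projective_module R M \<longleftrightarrow>
     (\<exists>(I :: 'm set) D. direct_summand R D (free_module R I)
        \<and> left_mod_iso R M (free_module R I \<lparr>carrier := D\<rparr>) \<noteq> {})"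

text \<open>
  The tensor product of a right \<open>S\<close>-module \<open>M\<close> and a left \<open>S\<close>-module \<open>N\<close> is the free abelian group on
  \<open>M \<times> N\<close> modulo the subgroup generated by the usual relations; its elements are cosets.
\<close>

definition tensor_rels ::
  "('s, 'a) ring_scheme \<Rightarrow> ('r, 's, 'm) bimod \<Rightarrow> ('s, 'n, 'e) module_scheme \<Rightarrow> ('m \<times> 'n \<Rightarrow>\<^sub>0 int) set"
  where
  "tensor_rels S M N =
     {frag_of (x \<oplus>\<^bsub>M\<^esub> x', y) - frag_of (x, y) - frag_of (x', y) |x x' y.
        x \<in> carrier M \<and> x' \<in> carrier M \<and> y \<in> carrier N} \<union>
     {frag_of (x, y \<oplus>\<^bsub>N\<^esub> y') - frag_of (x, y) - frag_of (x, y') |x y y'.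
        x \<in> carrier M \<and> y \<in> carrier N \<and> y' \<in> carrier N} \<union>
     {frag_of (rsmult M x s, y) - frag_of (x, s \<odot>\<^bsub>N\<^esub> y) |x s y.
        x \<in> carrier M \<and> s \<in> carrier S \<and> y \<in> carrier N}"

definition tensor_null ::
  "('s, 'a) ring_scheme \<Rightarrow> ('r, 's, 'm) bimod \<Rightarrow> ('s, 'n, 'e) module_scheme \<Rightarrow> ('m \<times> 'n \<Rightarrow>\<^sub>0 int) set"
  where
  "tensor_null S M N =
     generate (free_Abelian_group (carrier M \<times> carrier N)) (tensor_rels S M N)"

definition tensor_group ::
  "('s, 'a) ring_scheme \<Rightarrow> ('r, 's, 'm) bimod \<Rightarrow> ('s, 'n, 'e) module_scheme
    \<Rightarrow> ('m \<times> 'n \<Rightarrow>\<^sub>0 int) set monoid"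
  where
  "tensor_group S M N = free_Abelian_group (carrier M \<times> carrier N) Mod tensor_null S M N"

text \<open>
  The endomorphism \<open>x \<otimes> y \<mapsto> \<phi> x \<otimes> \<psi> y\<close> of the tensor product, for additive maps \<open>\<phi>\<close> and \<open>\<psi>\<close>
  commuting with the actions of \<open>S\<close>; it takes the coset of a representative \<open>z\<close> to the coset of the
  image of \<open>z\<close>.
\<close>

definition tensor_map ::
  "('s, 'a) ring_scheme \<Rightarrow> ('r, 's, 'm) bimod \<Rightarrow> ('s, 'n, 'e) module_scheme
    \<Rightarrow> ('m \<Rightarrow> 'm) \<Rightarrow> ('n \<Rightarrow> 'n) \<Rightarrow> ('m \<times> 'n \<Rightarrow>\<^sub>0 int) set \<Rightarrow> ('m \<times> 'n \<Rightarrow>\<^sub>0 int) set"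
  where
  "tensor_map S M N \<phi> \<psi> X =
     the_elem ((\<lambda>z. tensor_null S M N #>\<^bsub>free_Abelian_group (carrier M \<times> carrier N)\<^esub>
                  frag_extend (\<lambda>(x, y). frag_of (\<phi> x, \<psi> y)) z) ` X)"

definition tensor_bimod ::
  "('s, 'a) ring_scheme \<Rightarrow> ('r, 's, 'm) bimod \<Rightarrow> ('s, 't, 'n) bimod
    \<Rightarrow> ('r, 't, ('m \<times> 'n \<Rightarrow>\<^sub>0 int) set) bimod"
  where
  "tensor_bimod S M N =
     \<lparr> carrier = carrier (tensor_group S M N), monoid.mult = undefined, one = undefined,
       ring.zero = \<one>\<^bsub>tensor_group S M N\<^esub>, add = monoid.mult (tensor_group S M N),
       smult = (\<lambda>r. tensor_map S M N (\<lambda>x. r \<odot>\<^bsub>M\<^esub> x) (\<lambda>y. y)),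
       rsmult = (\<lambda>X t. tensor_map S M N (\<lambda>x. x) (\<lambda>y. rsmult N y t) X) \<rparr>"

text \<open>
  The tensor product as a bimodule both of whose actions come from the left factor, which besides its
  right \<open>S\<close>-action carries a second right action \<open>\<rho>\<close> commuting with the other two:
  \<open>r (x \<otimes> y) t = \<rho> (r x) t \<otimes> y\<close>.
\<close>

definition tensor_bimod_left_factor ::
  "('s, 'a) ring_scheme \<Rightarrow> ('r, 's, 'm) bimod \<Rightarrow> ('m \<Rightarrow> 't \<Rightarrow> 'm) \<Rightarrow> ('s, 'n, 'e) module_scheme
    \<Rightarrow> ('r, 't, ('m \<times> 'n \<Rightarrow>\<^sub>0 int) set) bimod"
  where
  "tensor_bimod_left_factor S M \<rho> N =
     \<lparr> carrier = carrier (tensor_group S M N), monoid.mult = undefined, one = undefined,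
       ring.zero = \<one>\<^bsub>tensor_group S M N\<^esub>, add = monoid.mult (tensor_group S M N),
       smult = (\<lambda>r. tensor_map S M N (\<lambda>x. r \<odot>\<^bsub>M\<^esub> x) (\<lambda>y. y)),
       rsmult = (\<lambda>X t. tensor_map S M N (\<lambda>x. \<rho> x t) (\<lambda>y. y) X) \<rparr>"

text \<open>The ring \<open>A\<close> as a bimodule along ring homomorphisms \<open>\<alpha>\<close> and \<open>\<beta>\<close> into \<open>A\<close>.\<close>

definition ring_bimod ::
  "('a, 'e) ring_scheme \<Rightarrow> ('r \<Rightarrow> 'a) \<Rightarrow> ('s \<Rightarrow> 'a) \<Rightarrow> ('r, 's, 'a) bimod"
  where
  "ring_bimod A \<alpha> \<beta> =
     \<lparr> carrier = carrier A, monoid.mult = undefined, one = undefined,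
       ring.zero = \<zero>\<^bsub>A\<^esub>, add = add A,
       smult = (\<lambda>r x. \<alpha> r \<otimes>\<^bsub>A\<^esub> x),
       rsmult = (\<lambda>x s. x \<otimes>\<^bsub>A\<^esub> \<beta> s) \<rparr>"

definition ring_tower ::
  "'a ring \<Rightarrow> 'b ring \<Rightarrow> 'c ring \<Rightarrow> ('b \<Rightarrow> 'a) \<Rightarrow> ('c \<Rightarrow> 'b) \<Rightarrow> bool"
  where
  "ring_tower A B C f g \<longleftrightarrow>
     ring A \<and> ring B \<and> ring C \<and> f \<in> ring_hom B A \<and> g \<in> ring_hom C B"

definition tensor_AA ::
  "'a ring \<Rightarrow> 'b ring \<Rightarrow> ('b \<Rightarrow> 'a) \<Rightarrow> ('c \<Rightarrow> 'b) \<Rightarrow> ('a, 'c, ('a \<times> 'a \<Rightarrow>\<^sub>0 int) set) bimod"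
  where
  "tensor_AA A B f g =
     tensor_bimod B (ring_bimod A (\<lambda>a. a) f) (ring_bimod A f (f \<circ> g))"

definition right_depth_three ::
  "'a ring \<Rightarrow> 'b ring \<Rightarrow> 'c ring \<Rightarrow> ('b \<Rightarrow> 'a) \<Rightarrow> ('c \<Rightarrow> 'b) \<Rightarrow> bool"
  where
  "right_depth_three A B C f g \<longleftrightarrow>
     (\<exists>N>0. \<exists>D. bimod_direct_summand A C D (bimod_power N (ring_bimod A (\<lambda>a. a) (f \<circ> g)))
        \<and> bimod_iso A C (tensor_AA A B f g)
            (bimod_power N (ring_bimod A (\<lambda>a. a) (f \<circ> g)) \<lparr>carrier := D\<rparr>) \<noteq> {})"

definition centralizer_ring :: "'a ring \<Rightarrow> 'c ring \<Rightarrow> ('c \<Rightarrow> 'a) \<Rightarrow> 'a ring"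
  where
  "centralizer_ring A C h =
     A \<lparr>carrier := {a \<in> carrier A. \<forall>c\<in>carrier C. a \<otimes>\<^bsub>A\<^esub> h c = h c \<otimes>\<^bsub>A\<^esub> a}\<rparr>"

text \<open>
  \<open>P = (A \<otimes>\<^sub>B A)\<^sup>C\<close>, a left \<open>V\<close>-module by restriction of the left action of \<open>A\<close>; \<open>module.truncate\<close>
  forgets the right action of \<open>C\<close>.
\<close>

definition tensor_centralizer ::
  "'a ring \<Rightarrow> 'b ring \<Rightarrow> 'c ring \<Rightarrow> ('b \<Rightarrow> 'a) \<Rightarrow> ('c \<Rightarrow> 'b) \<Rightarrow> ('a, ('a \<times> 'a \<Rightarrow>\<^sub>0 int) set) module"
  where
  "tensor_centralizer A B C f g =
     module.truncate (tensor_AA A B f g)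
       \<lparr>carrier := {p \<in> carrier (tensor_AA A B f g).
          \<forall>c\<in>carrier C. f (g c) \<odot>\<^bsub>tensor_AA A B f g\<^esub> p = rsmult (tensor_AA A B f g) p c}\<rparr>"

definition tensor_VP ::
  "'a ring \<Rightarrow> 'b ring \<Rightarrow> 'c ring \<Rightarrow> ('b \<Rightarrow> 'a) \<Rightarrow> ('c \<Rightarrow> 'b)
    \<Rightarrow> ('a, 'c, ('a \<times> ('a \<times> 'a \<Rightarrow>\<^sub>0 int) set \<Rightarrow>\<^sub>0 int) set) bimod"
  where
  "tensor_VP A B C f g =
     tensor_bimod_left_factor (centralizer_ring A C (f \<circ> g))
       (ring_bimod A (\<lambda>a. a) (\<lambda>v. v)) (\<lambda>a c. a \<otimes>\<^bsub>A\<^esub> f (g c))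
       (tensor_centralizer A B C f g)"

end

theory Submission
  imports Defs "HOL-Algebra.Subrings"
begin

text \<open>
  Nothing depends on the shape of \<open>A \<otimes>\<^sub>B A\<close>: for every \<open>A\<close>-\<open>C\<close>-bimodule \<open>Q\<close>, with \<open>P = Q\<^sup>C\<close>, being
  isomorphic to a summand of some \<open>A\<^sup>N\<close> is equivalent to \<open>P\<close> being finitely generated projective
  over \<open>V\<close> together with \<open>A \<otimes>\<^sub>V P \<cong> Q\<close>. A split embedding of \<open>Q\<close> into \<open>A\<^sup>N\<close> is a finite dual
  basis \<open>q = \<Sum>\<^sub>k \<phi>\<^sub>k q p\<^sub>k\<close> of bimodule maps \<open>\<phi>\<^sub>k : Q \<rightarrow> A\<close>, where the \<open>p\<^sub>k\<close> lie in \<open>P\<close> because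
  the unit vectors of \<open>A\<^sup>N\<close> commute with \<open>C\<close>. The \<open>\<phi>\<^sub>k\<close> map \<open>P\<close> into \<open>V\<close>, so they restrict to a
  dual basis of \<open>P\<close> over \<open>V\<close>. Conversely, a dual basis of \<open>P\<close> over \<open>V\<close> induces one of
  \<open>A \<otimes>\<^sub>V P\<close> by \<open>a \<otimes> p \<mapsto> a \<phi>\<^sub>k p\<close>, and it is carried over to \<open>Q\<close> by the given isomorphism.
\<close>

section \<open>Modules over arbitrary rings\<close>

text \<open>Where \<open>P\<close> and \<open>V\<close> come from: a left linear map from
  \<open>A\<close> to \<open>Q\<close> has the form a \<mapsto> a q, and it respects the right
  action of \<open>C\<close> exactly when q lies in \<open>P\<close>. For Q = A the same condition
  describes \<open>V\<close>. So P is Hom(A, Q), and V is the endomorphism ring of the bimodule A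
  with its multiplication reversed. The theorem is the case of A in the correspondence between
  direct summands of finite powers of an object and finitely generated projective modules over its
  endomorphism ring. Two points shape the converse. The isomorphism between A \<otimes> P and Q is
  arbitrary and need not be a \<otimes> p \<mapsto> a p, so the vectors found in Q are the images of
  1 \<otimes> b_k under it, in general different from the b_k. And \<open>projective_module\<close>
  allows free modules of infinite rank, so the finite index set has to be extracted from finite
  generation.\<close>

locale left_module = R: ring R + M: abelian_group M
  for R :: "('r, 'a) ring_scheme" and M :: "('r, 'm, 'e) module_scheme" +
  assumes smult_closed [simp]:
      "\<lbrakk>r \<in> carrier R; x \<in> carrier M\<rbrakk> \<Longrightarrow> r \<odot>\<^bsub>M\<^esub> x \<in> carrier M"
    and smult_l_distr:
      "\<lbrakk>r \<in> carrier R; r' \<in> carrier R; x \<in> carrier M\<rbrakk> \<Longrightarrow>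
        (r \<oplus>\<^bsub>R\<^esub> r') \<odot>\<^bsub>M\<^esub> x = r \<odot>\<^bsub>M\<^esub> x \<oplus>\<^bsub>M\<^esub> r' \<odot>\<^bsub>M\<^esub> x"
    and smult_r_distr:
      "\<lbrakk>r \<in> carrier R; x \<in> carrier M; y \<in> carrier M\<rbrakk> \<Longrightarrow>
        r \<odot>\<^bsub>M\<^esub> (x \<oplus>\<^bsub>M\<^esub> y) = r \<odot>\<^bsub>M\<^esub> x \<oplus>\<^bsub>M\<^esub> r \<odot>\<^bsub>M\<^esub> y"
    and smult_assoc:
      "\<lbrakk>r \<in> carrier R; r' \<in> carrier R; x \<in> carrier M\<rbrakk> \<Longrightarrow>
        (r \<otimes>\<^bsub>R\<^esub> r') \<odot>\<^bsub>M\<^esub> x = r \<odot>\<^bsub>M\<^esub> (r' \<odot>\<^bsub>M\<^esub> x)"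
    and smult_one [simp]: "x \<in> carrier M \<Longrightarrow> \<one>\<^bsub>R\<^esub> \<odot>\<^bsub>M\<^esub> x = x"

locale bimodule = left_module R M + S: ring S
  for R :: "('r, 'a) ring_scheme" and S :: "('s, 'b) ring_scheme" and M :: "('r, 's, 'm) bimod" +
  assumes rsmult_closed [simp]:
      "\<lbrakk>x \<in> carrier M; s \<in> carrier S\<rbrakk> \<Longrightarrow> rsmult M x s \<in> carrier M"
    and rsmult_l_distr:
      "\<lbrakk>x \<in> carrier M; y \<in> carrier M; s \<in> carrier S\<rbrakk> \<Longrightarrow>
        rsmult M (x \<oplus>\<^bsub>M\<^esub> y) s = rsmult M x s \<oplus>\<^bsub>M\<^esub> rsmult M y s"
    and rsmult_r_distr:
      "\<lbrakk>x \<in> carrier M; s \<in> carrier S; s' \<in> carrier S\<rbrakk> \<Longrightarrow>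
        rsmult M x (s \<oplus>\<^bsub>S\<^esub> s') = rsmult M x s \<oplus>\<^bsub>M\<^esub> rsmult M x s'"
    and rsmult_assoc:
      "\<lbrakk>x \<in> carrier M; s \<in> carrier S; s' \<in> carrier S\<rbrakk> \<Longrightarrow>
        rsmult M x (s \<otimes>\<^bsub>S\<^esub> s') = rsmult M (rsmult M x s) s'"
    and rsmult_one [simp]: "x \<in> carrier M \<Longrightarrow> rsmult M x \<one>\<^bsub>S\<^esub> = x"
    and smult_rsmult:
      "\<lbrakk>r \<in> carrier R; x \<in> carrier M; s \<in> carrier S\<rbrakk> \<Longrightarrow>
        rsmult M (r \<odot>\<^bsub>M\<^esub> x) s = r \<odot>\<^bsub>M\<^esub> rsmult M x s"

text \<open>Only the additive fields of the records are involved, so a ring, a module and a tensor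
  product can serve alike as source or target, and the facts on zero, negatives and finite sums are
  proved once. Values outside the carrier are left open; maps are compared on the carrier
  only.\<close>

definition add_hom :: "('m, 'e) ring_scheme \<Rightarrow> ('n, 'f) ring_scheme \<Rightarrow> ('m \<Rightarrow> 'n) set" where
  "add_hom M N =
     {h \<in> carrier M \<rightarrow> carrier N. \<forall>x\<in>carrier M. \<forall>y\<in>carrier M. h (x \<oplus>\<^bsub>M\<^esub> y) = h x \<oplus>\<^bsub>N\<^esub> h y}"

definition left_mod_hom ::
  "('r, 'a) ring_scheme \<Rightarrow> ('r, 'm, 'e) module_scheme \<Rightarrow> ('r, 'n, 'f) module_scheme \<Rightarrow> ('m \<Rightarrow> 'n) set"
  where
  "left_mod_hom R M N =
     {h \<in> add_hom M N. \<forall>r\<in>carrier R. \<forall>x\<in>carrier M. h (r \<odot>\<^bsub>M\<^esub> x) = r \<odot>\<^bsub>N\<^esub> h x}"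

definition bimod_hom ::
  "('r, 'a) ring_scheme \<Rightarrow> ('s, 'b) ring_scheme \<Rightarrow> ('r, 's, 'm) bimod \<Rightarrow> ('r, 's, 'n) bimod
    \<Rightarrow> ('m \<Rightarrow> 'n) set"
  where
  "bimod_hom R S M N =
     {h \<in> left_mod_hom R M N. \<forall>x\<in>carrier M. \<forall>s\<in>carrier S. h (rsmult M x s) = rsmult N (h x) s}"

lemma add_homI:
  assumes "\<And>x. x \<in> carrier M \<Longrightarrow> h x \<in> carrier N"
    and "\<And>x y. \<lbrakk>x \<in> carrier M; y \<in> carrier M\<rbrakk> \<Longrightarrow> h (x \<oplus>\<^bsub>M\<^esub> y) = h x \<oplus>\<^bsub>N\<^esub> h y"
  shows "h \<in> add_hom M N"
  using assms by (auto simp: add_hom_def)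

lemma left_mod_homI:
  assumes "h \<in> add_hom M N"
    and "\<And>r x. \<lbrakk>r \<in> carrier R; x \<in> carrier M\<rbrakk> \<Longrightarrow> h (r \<odot>\<^bsub>M\<^esub> x) = r \<odot>\<^bsub>N\<^esub> h x"
  shows "h \<in> left_mod_hom R M N"
  using assms by (auto simp: left_mod_hom_def)

lemma bimod_homI:
  assumes "h \<in> left_mod_hom R M N"
    and "\<And>x s. \<lbrakk>x \<in> carrier M; s \<in> carrier S\<rbrakk> \<Longrightarrow> h (rsmult M x s) = rsmult N (h x) s"
  shows "h \<in> bimod_hom R S M N"
  using assms by (auto simp: bimod_hom_def)

lemma
  assumes "h \<in> add_hom M N"
  shows add_hom_closed: "x \<in> carrier M \<Longrightarrow> h x \<in> carrier N"
    and add_hom_add: "\<lbrakk>x \<in> carrier M; y \<in> carrier M\<rbrakk> \<Longrightarrow> h (x \<oplus>\<^bsub>M\<^esub> y) = h x \<oplus>\<^bsub>N\<^esub> h y"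
  using assms by (auto simp: add_hom_def)

lemma
  assumes "h \<in> left_mod_hom R M N"
  shows left_mod_hom_add_hom: "h \<in> add_hom M N"
    and left_mod_hom_smult: "\<lbrakk>r \<in> carrier R; x \<in> carrier M\<rbrakk> \<Longrightarrow> h (r \<odot>\<^bsub>M\<^esub> x) = r \<odot>\<^bsub>N\<^esub> h x"
  using assms by (auto simp: left_mod_hom_def)

lemma
  assumes "h \<in> bimod_hom R S M N"
  shows bimod_hom_left_mod_hom: "h \<in> left_mod_hom R M N"
    and bimod_hom_add_hom: "h \<in> add_hom M N"
    and bimod_hom_rsmult:
      "\<lbrakk>x \<in> carrier M; s \<in> carrier S\<rbrakk> \<Longrightarrow> h (rsmult M x s) = rsmult N (h x) s"
  using assms by (auto simp: bimod_hom_def left_mod_hom_def)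

lemma left_mod_iso_iff:
  "h \<in> left_mod_iso R M N \<longleftrightarrow> h \<in> left_mod_hom R M N \<and> bij_betw h (carrier M) (carrier N)"
  by (auto simp: left_mod_iso_def left_mod_hom_def add_hom_def bij_betw_def)

lemma bimod_iso_iff:
  "h \<in> bimod_iso R S M N \<longleftrightarrow> h \<in> bimod_hom R S M N \<and> bij_betw h (carrier M) (carrier N)"
  by (auto simp: bimod_iso_def bimod_hom_def left_mod_iso_iff)

lemma add_hom_comp:
  "\<lbrakk>h \<in> add_hom M N; k \<in> add_hom N L\<rbrakk> \<Longrightarrow> (\<lambda>x. k (h x)) \<in> add_hom M L"
  by (auto simp: add_hom_def Pi_iff)

lemma left_mod_hom_comp:
  "\<lbrakk>h \<in> left_mod_hom R M N; k \<in> left_mod_hom R N L\<rbrakk> \<Longrightarrow> (\<lambda>x. k (h x)) \<in> left_mod_hom R M L"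
  by (auto simp: left_mod_hom_def add_hom_def Pi_iff)

lemma bimod_hom_comp:
  "\<lbrakk>h \<in> bimod_hom R S M N; k \<in> bimod_hom R S N L\<rbrakk> \<Longrightarrow> (\<lambda>x. k (h x)) \<in> bimod_hom R S M L"
  by (auto simp: bimod_hom_def left_mod_hom_def add_hom_def Pi_iff)

lemma add_hom_zero:
  assumes "abelian_group M" "abelian_group N" "h \<in> add_hom M N"
  shows "h \<zero>\<^bsub>M\<^esub> = \<zero>\<^bsub>N\<^esub>"
proof -
  interpret M: abelian_group M by fact
  interpret N: abelian_group N by fact
  have "h \<zero>\<^bsub>M\<^esub> \<in> carrier N" "h \<zero>\<^bsub>M\<^esub> \<oplus>\<^bsub>N\<^esub> h \<zero>\<^bsub>M\<^esub> = h \<zero>\<^bsub>M\<^esub>"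
    using add_hom_closed[OF assms(3)] add_hom_add[OF assms(3), of "\<zero>\<^bsub>M\<^esub>" "\<zero>\<^bsub>M\<^esub>"] by auto
  then show ?thesis by (metis N.add.r_cancel_one)
qed

lemma add_hom_a_inv:
  assumes "abelian_group M" "abelian_group N" "h \<in> add_hom M N" "x \<in> carrier M"
  shows "h (\<ominus>\<^bsub>M\<^esub> x) = \<ominus>\<^bsub>N\<^esub> h x"
proof -
  interpret M: abelian_group M by fact
  interpret N: abelian_group N by fact
  have "h (\<ominus>\<^bsub>M\<^esub> x) \<oplus>\<^bsub>N\<^esub> h x = \<zero>\<^bsub>N\<^esub>"
    using add_hom_add[OF assms(3), of "\<ominus>\<^bsub>M\<^esub> x" x] assms(4) add_hom_zero[OF assms(1-3)]
    by (simp add: M.l_neg)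
  then show ?thesis
    using add_hom_closed[OF assms(3)] assms(4) by (metis M.a_inv_closed N.minus_equality)
qed

lemma add_hom_finsum:
  assumes "abelian_group M" "abelian_group N" "h \<in> add_hom M N" "f \<in> J \<rightarrow> carrier M"
  shows "h (finsum M f J) = finsum N (\<lambda>j. h (f j)) J"
proof -
  interpret M: abelian_group M by fact
  interpret N: abelian_group N by fact
  show ?thesis
    using assms(4)
  \<comment> \<open>Over an infinite index set both sums have the default value zero, so this case
    reduces to \<open>add_hom_zero\<close>.\<close>
  proof (induction J rule: infinite_finite_induct)
    case (insert j J)
    then show ?case
      by (simp add: Pi_iff add_hom_closed[OF assms(3)] add_hom_add[OF assms(3)])
  qed (simp_all add: add_hom_zero[OF assms(1-3)])
qed

lemma add_hom_id: "(\<lambda>x. x) \<in> add_hom M M"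
  by (simp add: add_hom_def)

context left_module
begin

lemma smult_add_hom: "r \<in> carrier R \<Longrightarrow> (\<lambda>x. r \<odot>\<^bsub>M\<^esub> x) \<in> add_hom M M"
  by (rule add_homI) (auto simp: smult_r_distr)

lemma smult_add_hom_left: "x \<in> carrier M \<Longrightarrow> (\<lambda>r. r \<odot>\<^bsub>M\<^esub> x) \<in> add_hom R M"
  by (rule add_homI) (auto simp: smult_l_distr)

lemma smult_l_null [simp]: "x \<in> carrier M \<Longrightarrow> \<zero>\<^bsub>R\<^esub> \<odot>\<^bsub>M\<^esub> x = \<zero>\<^bsub>M\<^esub>"
  by (rule add_hom_zero[OF R.abelian_group_axioms M.abelian_group_axioms smult_add_hom_left])

lemma smult_r_null [simp]: "r \<in> carrier R \<Longrightarrow> r \<odot>\<^bsub>M\<^esub> \<zero>\<^bsub>M\<^esub> = \<zero>\<^bsub>M\<^esub>"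
  by (rule add_hom_zero[OF M.abelian_group_axioms M.abelian_group_axioms smult_add_hom])

end

lemma (in bimodule) rsmult_add_hom: "s \<in> carrier S \<Longrightarrow> (\<lambda>x. rsmult M x s) \<in> add_hom M M"
  by (rule add_homI) (auto simp: rsmult_l_distr)

lemma ring_bimod_simps [simp]:
  "carrier (ring_bimod A \<alpha> \<beta>) = carrier A"
  "\<zero>\<^bsub>ring_bimod A \<alpha> \<beta>\<^esub> = \<zero>\<^bsub>A\<^esub>"
  "x \<oplus>\<^bsub>ring_bimod A \<alpha> \<beta>\<^esub> y = x \<oplus>\<^bsub>A\<^esub> y"
  "r \<odot>\<^bsub>ring_bimod A \<alpha> \<beta>\<^esub> x = \<alpha> r \<otimes>\<^bsub>A\<^esub> x"
  "rsmult (ring_bimod A \<alpha> \<beta>) x s = x \<otimes>\<^bsub>A\<^esub> \<beta> s"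
  by (simp_all add: ring_bimod_def)

lemma abelian_group_ring_bimod:
  assumes "ring A"
  shows "abelian_group (ring_bimod A \<alpha> \<beta>)"
proof -
  interpret A: ring A by fact
  show ?thesis
    by (rule abelian_groupI) (auto simp: A.a_ac intro: A.l_neg)
qed

lemma left_module_ring_bimod:
  assumes "ring A" "ring R" "\<alpha> \<in> ring_hom R A"
  shows "left_module R (ring_bimod A \<alpha> \<beta>)"
proof -
  interpret A: ring A by fact
  show ?thesis
    using assms abelian_group_ring_bimod[OF assms(1)]
    by (intro left_module.intro left_module_axioms.intro)
      (auto simp: ring_hom_closed ring_hom_add ring_hom_mult ring_hom_one A.l_distr A.r_distr A.m_assoc)
qed

lemma bimodule_ring_bimod:
  assumes "ring A" "ring R" "ring S" "\<alpha> \<in> ring_hom R A" "\<beta> \<in> ring_hom S A"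
  shows "bimodule R S (ring_bimod A \<alpha> \<beta>)"
proof -
  interpret A: ring A by fact
  show ?thesis
    using assms
    by (intro bimodule.intro bimodule_axioms.intro left_module_ring_bimod)
      (auto simp: ring_hom_closed ring_hom_add ring_hom_mult ring_hom_one A.l_distr A.r_distr A.m_assoc)
qed

section \<open>Direct summands and retractions\<close>

text \<open>The idempotent \<open>i \<circ> p\<close> splits \<open>G\<close> into its image
  \<open>D\<close> and its kernel \<open>L\<close>: in x = i (p x) + (x - i (p x)) the second term
  is killed by \<open>p\<close>. At the level of abelian groups this serves modules and bimodules;
  they add only closure under their scalars.\<close>

lemma retract_direct_sum:
  assumes "abelian_group M" "abelian_group G" "i \<in> add_hom M G" "p \<in> add_hom G M"
    and pi: "\<And>m. m \<in> carrier M \<Longrightarrow> p (i m) = m"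
  defines "D \<equiv> i ` carrier M" and "L \<equiv> {x \<in> carrier G. p x = \<zero>\<^bsub>M\<^esub>}"
  shows "subgroup D (add_monoid G)" "subgroup L (add_monoid G)"
    "D \<inter> L = {\<zero>\<^bsub>G\<^esub>}" "D <+>\<^bsub>G\<^esub> L = carrier G" "bij_betw i (carrier M) D"
proof -
  interpret M: abelian_group M by fact
  interpret G: abelian_group G by fact
  note i = add_hom_closed[OF assms(3)] add_hom_add[OF assms(3)] add_hom_zero[OF assms(1-3)]
    add_hom_a_inv[OF assms(1-3)]
  note p = add_hom_closed[OF assms(4)] add_hom_add[OF assms(4)] add_hom_zero[OF assms(2,1,4)]
    add_hom_a_inv[OF assms(2,1,4)]
  show "subgroup D (add_monoid G)"
  proof (rule G.add.subgroupI)
    show "\<ominus>\<^bsub>G\<^esub> a \<in> D" if "a \<in> D" for a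
      using that i(4) unfolding D_def by (metis (no_types, lifting) M.a_inv_closed image_iff)
    show "a \<oplus>\<^bsub>G\<^esub> b \<in> D" if "a \<in> D" "b \<in> D" for a b
      using that i(2) unfolding D_def by (metis (no_types, lifting) M.a_closed image_iff)
  qed (auto simp: D_def i)
  show "subgroup L (add_monoid G)"
    by (rule G.add.subgroupI) (auto simp: L_def p)
  show "D \<inter> L = {\<zero>\<^bsub>G\<^esub>}"
    using i(3) p(3) pi by (force simp: D_def L_def)
  show "D <+>\<^bsub>G\<^esub> L = carrier G"
  proof
    show "D <+>\<^bsub>G\<^esub> L \<subseteq> carrier G"
      by (auto simp: set_add_def' D_def L_def i)
    show "carrier G \<subseteq> D <+>\<^bsub>G\<^esub> L"
    proof
      fix x assume x: "x \<in> carrier G"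
      define d l where "d = i (p x)" and "l = \<ominus>\<^bsub>G\<^esub> i (p x) \<oplus>\<^bsub>G\<^esub> x"
      have "d \<in> D" "l \<in> L" "x = d \<oplus>\<^bsub>G\<^esub> l"
        using x by (auto simp: d_def l_def D_def L_def i p pi M.l_neg G.r_neg2)
      then show "x \<in> D <+>\<^bsub>G\<^esub> L"
        by (auto simp: set_add_def')
    qed
  qed
  show "bij_betw i (carrier M) D"
    using pi by (auto simp: D_def bij_betw_def inj_on_def) metis
qed

text \<open>
  The retraction commutes with every operator that respects the decomposition; this yields the
  linearity of the retraction for left modules and for bimodules alike.
\<close>

lemma direct_sum_retraction:
  assumes "abelian_group M" "abelian_group G"
    and D: "subgroup D (add_monoid G)" and L: "subgroup L (add_monoid G)"
    and DL: "D \<inter> L = {\<zero>\<^bsub>G\<^esub>}" "D <+>\<^bsub>G\<^esub> L = carrier G"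
    and h: "h \<in> add_hom M G" "bij_betw h (carrier M) D"
  obtains p where "p \<in> add_hom G M" "\<And>m. m \<in> carrier M \<Longrightarrow> p (h m) = m"
    "\<And>u u' x. \<lbrakk>u \<in> add_hom G G; u ` D \<subseteq> D; u ` L \<subseteq> L; u' \<in> carrier M \<rightarrow> carrier M;
       \<And>m. m \<in> carrier M \<Longrightarrow> h (u' m) = u (h m); x \<in> carrier G\<rbrakk> \<Longrightarrow> p (u x) = u' (p x)"
proof -
  interpret M: abelian_group M by fact
  interpret G: abelian_group G by fact
  note h' = add_hom_closed[OF h(1)] add_hom_add[OF h(1)] add_hom_zero[OF assms(1,2) h(1)]
    add_hom_a_inv[OF assms(1,2) h(1)]
  have sub: "D \<subseteq> carrier G" "L \<subseteq> carrier G"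
    using subgroup.subset[OF D] subgroup.subset[OF L] by auto
  have addL: "x \<oplus>\<^bsub>G\<^esub> y \<in> L" if "x \<in> L" "y \<in> L" for x y
    using subgroup.m_closed[OF L] that by simp
  have minusL: "\<ominus>\<^bsub>G\<^esub> x \<in> L" if "x \<in> L" for x
    using subgroup.m_inv_closed[OF L] that by (simp add: a_inv_def)
  have hD: "h m \<in> D" if "m \<in> carrier M" for m
    using h(2) that by (auto simp: bij_betw_def)
  have ex: "\<exists>m\<in>carrier M. \<exists>l\<in>L. x = h m \<oplus>\<^bsub>G\<^esub> l" if "x \<in> carrier G" for x
  proof -
    have "x \<in> D <+>\<^bsub>G\<^esub> L" using that DL by simp
    then show ?thesis
      using h(2) by (auto simp: set_add_def' bij_betw_def)
  qed
  \<comment> \<open>Two decompositions of one element give h m - h m' = l' - l, which lies in both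
    \<open>D\<close> and \<open>L\<close> and hence is zero; then injectivity of \<open>h\<close>
    applies.\<close>
  have uniq: "m = m'"
    if "m \<in> carrier M" "m' \<in> carrier M" "l \<in> L" "l' \<in> L" "h m \<oplus>\<^bsub>G\<^esub> l = h m' \<oplus>\<^bsub>G\<^esub> l'" for m m' l l'
  proof -
    have c: "h m \<in> carrier G" "h m' \<in> carrier G" "l \<in> carrier G" "l' \<in> carrier G"
      using that h' sub by auto
    have "h (m \<oplus>\<^bsub>M\<^esub> \<ominus>\<^bsub>M\<^esub> m') = h m \<oplus>\<^bsub>G\<^esub> \<ominus>\<^bsub>G\<^esub> h m'"
      using that h' by simp
    also have "h m = h m' \<oplus>\<^bsub>G\<^esub> l' \<oplus>\<^bsub>G\<^esub> \<ominus>\<^bsub>G\<^esub> l"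
      using c that(5) by (metis G.add.inv_solve_right G.a_closed)
    also have "\<dots> \<oplus>\<^bsub>G\<^esub> \<ominus>\<^bsub>G\<^esub> h m' = l' \<oplus>\<^bsub>G\<^esub> \<ominus>\<^bsub>G\<^esub> l"
      using c by (metis G.a_closed G.a_comm G.a_inv_closed G.r_neg1 G.a_assoc)
    finally have "h (m \<oplus>\<^bsub>M\<^esub> \<ominus>\<^bsub>M\<^esub> m') \<in> D \<inter> L"
      using that hD[of "m \<oplus>\<^bsub>M\<^esub> \<ominus>\<^bsub>M\<^esub> m'"] addL minusL by auto
    then have "h (m \<oplus>\<^bsub>M\<^esub> \<ominus>\<^bsub>M\<^esub> m') = h \<zero>\<^bsub>M\<^esub>"
      using DL h' by simp
    then have "m \<oplus>\<^bsub>M\<^esub> \<ominus>\<^bsub>M\<^esub> m' = \<zero>\<^bsub>M\<^esub>"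
      using h(2) that by (auto simp: bij_betw_def inj_on_def)
    then show ?thesis
      using that by (metis M.a_inv_closed M.minus_equality M.minus_minus)
  qed
  \<comment> \<open>The \<open>D\<close>-component of x, pulled back along \<open>h\<close>. By
    \<open>uniq\<close> there is no real choice, which is what makes \<open>p\<close>
    additive.\<close>
  define p where "p x = (SOME m. m \<in> carrier M \<and> (\<exists>l\<in>L. x = h m \<oplus>\<^bsub>G\<^esub> l))" for x
  have p: "p x \<in> carrier M" "\<exists>l\<in>L. x = h (p x) \<oplus>\<^bsub>G\<^esub> l" if "x \<in> carrier G" for x
    using someI_ex[of "\<lambda>m. m \<in> carrier M \<and> (\<exists>l\<in>L. x = h m \<oplus>\<^bsub>G\<^esub> l)"] ex[OF that]
    unfolding p_def by blast+
  have p_eq: "p (h m \<oplus>\<^bsub>G\<^esub> l) = m" if "m \<in> carrier M" "l \<in> L" for m l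
  proof -
    have "h m \<oplus>\<^bsub>G\<^esub> l \<in> carrier G"
      using that h' sub by auto
    from p[OF this] show ?thesis
      using uniq that by metis
  qed
  show thesis
  proof
    show "p \<in> add_hom G M"
    proof (rule add_homI)
      fix x y assume xy: "x \<in> carrier G" "y \<in> carrier G"
      obtain l l' where l: "l \<in> L" "x = h (p x) \<oplus>\<^bsub>G\<^esub> l" "l' \<in> L" "y = h (p y) \<oplus>\<^bsub>G\<^esub> l'"
        using p xy by meson
      have c: "h (p x) \<in> carrier G" "h (p y) \<in> carrier G" "l \<in> carrier G" "l' \<in> carrier G"
        using xy l h' sub p by auto
      have "x \<oplus>\<^bsub>G\<^esub> y = (h (p x) \<oplus>\<^bsub>G\<^esub> l) \<oplus>\<^bsub>G\<^esub> (h (p y) \<oplus>\<^bsub>G\<^esub> l')"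
        using l by simp
      also have "\<dots> = h (p x \<oplus>\<^bsub>M\<^esub> p y) \<oplus>\<^bsub>G\<^esub> (l \<oplus>\<^bsub>G\<^esub> l')"
        using c p xy by (simp add: h' G.a_ac)
      finally show "p (x \<oplus>\<^bsub>G\<^esub> y) = p x \<oplus>\<^bsub>M\<^esub> p y"
        using p_eq[of "p x \<oplus>\<^bsub>M\<^esub> p y" "l \<oplus>\<^bsub>G\<^esub> l'"] p xy addL l by simp
    qed (rule p)
    show "p (h m) = m" if "m \<in> carrier M" for m
      using p_eq[OF that, of "\<zero>\<^bsub>G\<^esub>"] h' that subgroup.one_closed[OF L] by simp
    \<comment> \<open>Since \<open>u\<close> preserves both parts, u x = h (u' (p x)) + u l is again
      a decomposition along \<open>D\<close> and \<open>L\<close>, and its component can be read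
      off.\<close>
    fix u u' x
    assume u: "u \<in> add_hom G G" "u ` D \<subseteq> D" "u ` L \<subseteq> L" "u' \<in> carrier M \<rightarrow> carrier M"
      "\<And>m. m \<in> carrier M \<Longrightarrow> h (u' m) = u (h m)" and x: "x \<in> carrier G"
    obtain l where l: "l \<in> L" "x = h (p x) \<oplus>\<^bsub>G\<^esub> l"
      using p x by meson
    then have "u x = u (h (p x)) \<oplus>\<^bsub>G\<^esub> u l"
      using add_hom_add[OF u(1), of "h (p x)" l] h' p x sub by auto
    then have "u x = h (u' (p x)) \<oplus>\<^bsub>G\<^esub> u l"
      using u(5) p x by simp
    then show "p (u x) = u' (p x)"
      using p_eq[of "u' (p x)" "u l"] u(3,4) p(1)[OF x] l(1) by (auto simp: Pi_iff image_subset_iff)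
  qed
qed

text \<open>The retraction is the projection onto \<open>D\<close> along the complement, followed by
  the inverse of \<open>h\<close>. Its linearity is the operator clause of
  \<open>direct_sum_retraction\<close> for multiplication by a scalar, under which both submodules
  are stable.\<close>

lemma (in left_module) direct_summand_retraction:
  assumes "left_module R F" "direct_summand R D F" "h \<in> left_mod_iso R M (F\<lparr>carrier := D\<rparr>)"
  obtains p where "h \<in> left_mod_hom R M F" "p \<in> left_mod_hom R F M"
    "\<And>m. m \<in> carrier M \<Longrightarrow> p (h m) = m"
proof -
  interpret F: left_module R F by fact
  obtain L where D: "submodule D R F" and L: "submodule L R F"
    and DL: "D \<inter> L = {\<zero>\<^bsub>F\<^esub>}" "D <+>\<^bsub>F\<^esub> L = carrier F"
    using assms(2) by (auto simp: direct_summand_def)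
  have sub: "D \<subseteq> carrier F"
    using subgroup.subset[OF submodule.axioms(1)[OF D]] by simp
  have h: "h \<in> left_mod_hom R M F" "bij_betw h (carrier M) D"
    using assms(3) sub by (auto simp: left_mod_iso_iff left_mod_hom_def add_hom_def Pi_iff)
  obtain p where p: "p \<in> add_hom F M" "\<And>m. m \<in> carrier M \<Longrightarrow> p (h m) = m"
    "\<And>u u' x. \<lbrakk>u \<in> add_hom F F; u ` D \<subseteq> D; u ` L \<subseteq> L; u' \<in> carrier M \<rightarrow> carrier M;
       \<And>m. m \<in> carrier M \<Longrightarrow> h (u' m) = u (h m); x \<in> carrier F\<rbrakk> \<Longrightarrow> p (u x) = u' (p x)"
    using direct_sum_retraction[OF M.abelian_group_axioms F.M.abelian_group_axioms
        submodule.axioms(1)[OF D] submodule.axioms(1)[OF L] DL left_mod_hom_add_hom[OF h(1)] h(2)]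
    by blast
  have "p \<in> left_mod_hom R F M"
  proof (rule left_mod_homI[OF p(1)])
    fix r x assume "r \<in> carrier R" "x \<in> carrier F"
    then show "p (r \<odot>\<^bsub>F\<^esub> x) = r \<odot>\<^bsub>M\<^esub> p x"
      using submodule.smult_closed[OF D] submodule.smult_closed[OF L] left_mod_hom_smult[OF h(1)]
      by (intro p(3)[where u = "\<lambda>x. r \<odot>\<^bsub>F\<^esub> x" and u' = "\<lambda>x. r \<odot>\<^bsub>M\<^esub> x"] F.smult_add_hom)
        auto
  qed
  with h p that show thesis by blast
qed

lemma (in left_module) retract_direct_summand:
  assumes "left_module R F" "i \<in> left_mod_hom R M F" "p \<in> left_mod_hom R F M"
    and pi: "\<And>m. m \<in> carrier M \<Longrightarrow> p (i m) = m"
  shows "direct_summand R (i ` carrier M) F"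
    and "i \<in> left_mod_iso R M (F\<lparr>carrier := i ` carrier M\<rparr>)"
proof -
  interpret F: left_module R F by fact
  note ds = retract_direct_sum[OF M.abelian_group_axioms F.M.abelian_group_axioms
      left_mod_hom_add_hom[OF assms(2)] left_mod_hom_add_hom[OF assms(3)] pi]
  let ?L = "{x \<in> carrier F. p x = \<zero>\<^bsub>M\<^esub>}"
  have "submodule (i ` carrier M) R F"
    using ds(1) left_mod_hom_smult[OF assms(2), symmetric]
    by (auto intro!: submodule.intro submodule_axioms.intro)
  moreover have "submodule ?L R F"
    using ds(2) left_mod_hom_smult[OF assms(3)]
    by (auto intro!: submodule.intro submodule_axioms.intro)
  ultimately show "direct_summand R (i ` carrier M) F"
    using ds(3,4) unfolding direct_summand_def by blast
  show "i \<in> left_mod_iso R M (F\<lparr>carrier := i ` carrier M\<rparr>)"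
    using assms(2) ds(5) by (auto simp: left_mod_iso_iff left_mod_hom_def add_hom_def)
qed

lemma (in bimodule) bimod_direct_summand_retraction:
  assumes "bimodule R S F" "bimod_direct_summand R S D F"
    and "h \<in> bimod_iso R S M (F\<lparr>carrier := D\<rparr>)"
  obtains p where "h \<in> bimod_hom R S M F" "p \<in> bimod_hom R S F M"
    "\<And>m. m \<in> carrier M \<Longrightarrow> p (h m) = m"
proof -
  interpret F: bimodule R S F by fact
  obtain L where D: "sub_bimod R S D F" and L: "sub_bimod R S L F"
    and DL: "D \<inter> L = {\<zero>\<^bsub>F\<^esub>}" "D <+>\<^bsub>F\<^esub> L = carrier F"
    using assms(2) by (auto simp: bimod_direct_summand_def)
  have D': "subgroup D (add_monoid F)" and L': "subgroup L (add_monoid F)"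
    using D L by (auto simp: sub_bimod_def submodule_def)
  have sub: "D \<subseteq> carrier F"
    using subgroup.subset[OF D'] by simp
  have h: "h \<in> bimod_hom R S M F" "bij_betw h (carrier M) D"
    using assms(3) sub by (auto simp: bimod_iso_iff bimod_hom_def left_mod_hom_def add_hom_def Pi_iff)
  obtain p where p: "p \<in> add_hom F M" "\<And>m. m \<in> carrier M \<Longrightarrow> p (h m) = m"
    "\<And>u u' x. \<lbrakk>u \<in> add_hom F F; u ` D \<subseteq> D; u ` L \<subseteq> L; u' \<in> carrier M \<rightarrow> carrier M;
       \<And>m. m \<in> carrier M \<Longrightarrow> h (u' m) = u (h m); x \<in> carrier F\<rbrakk> \<Longrightarrow> p (u x) = u' (p x)"
    using direct_sum_retraction[OF M.abelian_group_axioms F.M.abelian_group_axioms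
        D' L' DL bimod_hom_add_hom[OF h(1)] h(2)]
    by blast
  have "p \<in> bimod_hom R S F M"
  proof (intro bimod_homI left_mod_homI[OF p(1)])
    fix r x assume "r \<in> carrier R" "x \<in> carrier F"
    then show "p (r \<odot>\<^bsub>F\<^esub> x) = r \<odot>\<^bsub>M\<^esub> p x"
      using D L left_mod_hom_smult[OF bimod_hom_left_mod_hom[OF h(1)]]
      by (intro p(3)[where u = "\<lambda>x. r \<odot>\<^bsub>F\<^esub> x" and u' = "\<lambda>x. r \<odot>\<^bsub>M\<^esub> x"] F.smult_add_hom)
        (auto simp: sub_bimod_def submodule.smult_closed)
  next
    fix x s assume "x \<in> carrier F" "s \<in> carrier S"
    then show "p (rsmult F x s) = rsmult M (p x) s"
      using D L bimod_hom_rsmult[OF h(1)]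
      by (intro p(3)[where u = "\<lambda>x. rsmult F x s" and u' = "\<lambda>x. rsmult M x s"] F.rsmult_add_hom)
        (auto simp: sub_bimod_def)
  qed
  with h p that show thesis by blast
qed

lemma (in bimodule) retract_bimod_direct_summand:
  assumes "bimodule R S F" "i \<in> bimod_hom R S M F" "p \<in> bimod_hom R S F M"
    and pi: "\<And>m. m \<in> carrier M \<Longrightarrow> p (i m) = m"
  shows "bimod_direct_summand R S (i ` carrier M) F"
    and "i \<in> bimod_iso R S M (F\<lparr>carrier := i ` carrier M\<rparr>)"
proof -
  interpret F: bimodule R S F by fact
  note ds = retract_direct_sum[OF M.abelian_group_axioms F.M.abelian_group_axioms
      bimod_hom_add_hom[OF assms(2)] bimod_hom_add_hom[OF assms(3)] pi]
  let ?L = "{x \<in> carrier F. p x = \<zero>\<^bsub>M\<^esub>}"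
  have "sub_bimod R S (i ` carrier M) F"
    using ds(1) left_mod_hom_smult[OF bimod_hom_left_mod_hom[OF assms(2)], symmetric]
      bimod_hom_rsmult[OF assms(2), symmetric]
    by (auto simp: sub_bimod_def intro!: submodule.intro submodule_axioms.intro)
  moreover have "sub_bimod R S ?L F"
    using ds(2) left_mod_hom_smult[OF bimod_hom_left_mod_hom[OF assms(3)]]
      bimod_hom_rsmult[OF assms(3)] add_hom_zero[OF M.abelian_group_axioms M.abelian_group_axioms rsmult_add_hom]
    by (auto simp: sub_bimod_def intro!: submodule.intro submodule_axioms.intro)
  ultimately show "bimod_direct_summand R S (i ` carrier M) F"
    using ds(3,4) unfolding bimod_direct_summand_def by blast
  show "i \<in> bimod_iso R S M (F\<lparr>carrier := i ` carrier M\<rparr>)"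
    using assms(2) ds(5) by (auto simp: bimod_iso_iff bimod_hom_def left_mod_hom_def add_hom_def)
qed

section \<open>Free modules and dual bases\<close>

text \<open>The record \<open>F\<close> may have further fields, so that \<open>A\<^sup>N\<close> as a bimodule is also an instance.\<close>

locale free_left_module = R: ring R
  for R :: "('r, 'a) ring_scheme" and I :: "'i set" and F :: "('r, 'i \<Rightarrow> 'r, 'e) module_scheme" +
  assumes carrier_free: "carrier F = carrier (free_module R I)"
    and zero_free: "\<zero>\<^bsub>F\<^esub> = \<zero>\<^bsub>free_module R I\<^esub>"
    and add_free: "add F = add (free_module R I)"
    and smult_free: "smult F = smult (free_module R I)"
begin

lemma free_simps:
  "carrier F = {x \<in> I \<rightarrow>\<^sub>E carrier R. finite {i \<in> I. x i \<noteq> \<zero>\<^bsub>R\<^esub>}}"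
  "\<zero>\<^bsub>F\<^esub> = (\<lambda>i\<in>I. \<zero>\<^bsub>R\<^esub>)"
  "x \<oplus>\<^bsub>F\<^esub> y = (\<lambda>i\<in>I. x i \<oplus>\<^bsub>R\<^esub> y i)"
  "r \<odot>\<^bsub>F\<^esub> x = (\<lambda>i\<in>I. r \<otimes>\<^bsub>R\<^esub> x i)"
  by (simp_all add: carrier_free zero_free add_free smult_free free_module_def)

lemma free_at:
  assumes "i \<in> I"
  shows "\<zero>\<^bsub>F\<^esub> i = \<zero>\<^bsub>R\<^esub>" "(x \<oplus>\<^bsub>F\<^esub> y) i = x i \<oplus>\<^bsub>R\<^esub> y i" "(r \<odot>\<^bsub>F\<^esub> x) i = r \<otimes>\<^bsub>R\<^esub> x i"
  using assms by (simp_all add: free_simps)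

lemma free_add_closed:
  assumes "x \<in> carrier F" "y \<in> carrier F"
  shows "x \<oplus>\<^bsub>F\<^esub> y \<in> carrier F"
proof -
  have "{i \<in> I. x i \<oplus>\<^bsub>R\<^esub> y i \<noteq> \<zero>\<^bsub>R\<^esub>} \<subseteq> {i \<in> I. x i \<noteq> \<zero>\<^bsub>R\<^esub>} \<union> {i \<in> I. y i \<noteq> \<zero>\<^bsub>R\<^esub>}"
    by auto
  then show ?thesis
    using assms finite_subset by (fastforce simp: free_simps cong: conj_cong)
qed

lemma free_smult_closed:
  assumes "r \<in> carrier R" "x \<in> carrier F"
  shows "r \<odot>\<^bsub>F\<^esub> x \<in> carrier F"
proof -
  have "{i \<in> I. r \<otimes>\<^bsub>R\<^esub> x i \<noteq> \<zero>\<^bsub>R\<^esub>} \<subseteq> {i \<in> I. x i \<noteq> \<zero>\<^bsub>R\<^esub>}"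
    using assms by auto
  then show ?thesis
    using assms finite_subset by (fastforce simp: free_simps cong: conj_cong)
qed

lemma free_ext:
  assumes "x \<in> carrier F" "y \<in> carrier F" "\<And>i. i \<in> I \<Longrightarrow> x i = y i"
  shows "x = y"
  using assms by (auto simp: free_simps intro: PiE_ext)

lemma free_is_left_module: "left_module R F"
proof -
  have at: "x i \<in> carrier R" if "x \<in> carrier F" "i \<in> I" for x i
    using that by (auto simp: free_simps)
  have z: "\<zero>\<^bsub>F\<^esub> \<in> carrier F"
    by (simp add: free_simps cong: conj_cong)
  show ?thesis
  proof (intro left_module.intro left_module_axioms.intro)
    show "abelian_group F"
    proof (rule abelian_groupI)
      fix x y z assume "x \<in> carrier F" "y \<in> carrier F" "z \<in> carrier F"
      then show "x \<oplus>\<^bsub>F\<^esub> y \<oplus>\<^bsub>F\<^esub> z = x \<oplus>\<^bsub>F\<^esub> (y \<oplus>\<^bsub>F\<^esub> z)"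
        by (intro free_ext) (auto simp: free_add_closed at free_at R.a_assoc)
    next
      fix x y assume "x \<in> carrier F" "y \<in> carrier F"
      then show "x \<oplus>\<^bsub>F\<^esub> y = y \<oplus>\<^bsub>F\<^esub> x"
        by (intro free_ext) (auto simp: free_add_closed at free_at R.a_comm)
    next
      fix x assume x: "x \<in> carrier F"
      then show "\<zero>\<^bsub>F\<^esub> \<oplus>\<^bsub>F\<^esub> x = x"
        by (intro free_ext) (auto simp: free_add_closed z at free_at)
      \<comment> \<open>With (-1) x as the negative of x, the finiteness of its support is already
        known from \<open>free_smult_closed\<close>.\<close>
      have "(\<ominus>\<^bsub>R\<^esub> \<one>\<^bsub>R\<^esub>) \<odot>\<^bsub>F\<^esub> x \<in> carrier F"
        using x by (simp add: free_smult_closed)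
      moreover have "(\<ominus>\<^bsub>R\<^esub> \<one>\<^bsub>R\<^esub>) \<odot>\<^bsub>F\<^esub> x \<oplus>\<^bsub>F\<^esub> x = \<zero>\<^bsub>F\<^esub>"
        using x by (intro free_ext)
          (auto simp: free_add_closed free_smult_closed z at free_at R.l_minus R.l_neg)
      ultimately show "\<exists>y\<in>carrier F. y \<oplus>\<^bsub>F\<^esub> x = \<zero>\<^bsub>F\<^esub>"
        by blast
    qed (use free_add_closed z in auto)
    fix r r' x y assume rx: "r \<in> carrier R" "r' \<in> carrier R" "x \<in> carrier F" "y \<in> carrier F"
    show "(r \<oplus>\<^bsub>R\<^esub> r') \<odot>\<^bsub>F\<^esub> x = r \<odot>\<^bsub>F\<^esub> x \<oplus>\<^bsub>F\<^esub> r' \<odot>\<^bsub>F\<^esub> x"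
      using rx by (intro free_ext)
        (auto simp: free_add_closed free_smult_closed at free_at R.l_distr)
    show "r \<odot>\<^bsub>F\<^esub> (x \<oplus>\<^bsub>F\<^esub> y) = r \<odot>\<^bsub>F\<^esub> x \<oplus>\<^bsub>F\<^esub> r \<odot>\<^bsub>F\<^esub> y"
      using rx by (intro free_ext)
        (auto simp: free_add_closed free_smult_closed at free_at R.r_distr)
    show "(r \<otimes>\<^bsub>R\<^esub> r') \<odot>\<^bsub>F\<^esub> x = r \<odot>\<^bsub>F\<^esub> (r' \<odot>\<^bsub>F\<^esub> x)"
      using rx by (intro free_ext)
        (auto simp: free_smult_closed at free_at R.m_assoc)
  next
    fix x assume "x \<in> carrier F"
    then show "\<one>\<^bsub>R\<^esub> \<odot>\<^bsub>F\<^esub> x = x"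
      by (intro free_ext)
        (auto simp: free_smult_closed at free_at)
  qed (use free_smult_closed R.ring_axioms in auto)
qed

sublocale left_module R F
  by (rule free_is_left_module)

lemma eval_hom: "i \<in> I \<Longrightarrow> (\<lambda>x. x i) \<in> left_mod_hom R F (ring_bimod R (\<lambda>r. r) \<beta>)"
  by (intro left_mod_homI add_homI) (auto simp: free_simps)

definition unit_vec :: "'i \<Rightarrow> 'i \<Rightarrow> 'r" where
  "unit_vec k = (\<lambda>i\<in>I. if i = k then \<one>\<^bsub>R\<^esub> else \<zero>\<^bsub>R\<^esub>)"

lemma unit_vec_closed: "unit_vec k \<in> carrier F"
  by (auto simp: free_simps unit_vec_def intro: finite_subset[of _ "{k}"])

text \<open>\<open>J\<close> is any finite set that contains the support, not the support itself:
  one \<open>J\<close> can then serve all vectors in the image of a finitely generated module, or be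
  the whole of \<open>{..<N}\<close>.\<close>

lemma unit_vec_expansion:
  assumes "x \<in> carrier F" "finite J" "J \<subseteq> I" and x: "\<And>i. i \<in> I - J \<Longrightarrow> x i = \<zero>\<^bsub>R\<^esub>"
  shows "x = (\<Oplus>\<^bsub>F\<^esub>k\<in>J. x k \<odot>\<^bsub>F\<^esub> unit_vec k)"
proof (rule free_ext)
  have at: "x i \<in> carrier R" if "i \<in> I" for i
    using that assms(1) by (auto simp: free_simps)
  have c: "(\<lambda>k. x k \<odot>\<^bsub>F\<^esub> unit_vec k) \<in> J \<rightarrow> carrier F"
    using at assms(3) unit_vec_closed by auto
  then show "(\<Oplus>\<^bsub>F\<^esub>k\<in>J. x k \<odot>\<^bsub>F\<^esub> unit_vec k) \<in> carrier F"
    by (rule M.finsum_closed)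
  fix i assume i: "i \<in> I"
  \<comment> \<open>Evaluation at i is additive, so it may be taken inside the sum of
    vectors.\<close>
  have ev: "(\<lambda>x. x i) \<in> add_hom F R"
    using i by (auto intro!: add_homI simp: free_simps)
  have "(\<Oplus>\<^bsub>F\<^esub>k\<in>J. x k \<odot>\<^bsub>F\<^esub> unit_vec k) i = (\<Oplus>\<^bsub>R\<^esub>k\<in>J. if i = k then x k else \<zero>\<^bsub>R\<^esub>)"
    using i at assms(3)
    by (subst add_hom_finsum[OF M.abelian_group_axioms R.abelian_group_axioms ev c])
      (auto simp: free_simps(4) unit_vec_def intro!: R.finsum_cong')
  also have "\<dots> = x i"
  proof (cases "i \<in> J")
    case True
    then show ?thesis
      using R.finsum_singleton[OF True assms(2), of x] at assms(3) by auto
  next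
    case False
    have "(\<Oplus>\<^bsub>R\<^esub>k\<in>J. if i = k then x k else \<zero>\<^bsub>R\<^esub>) = (\<Oplus>\<^bsub>R\<^esub>k\<in>J. \<zero>\<^bsub>R\<^esub>)"
      using False by (intro R.finsum_cong') auto
    then show ?thesis
      using False i x by simp
  qed
  finally show "x i = (\<Oplus>\<^bsub>F\<^esub>k\<in>J. x k \<odot>\<^bsub>F\<^esub> unit_vec k) i"
    by simp
qed (rule assms)

end

lemma free_left_module_free_module: "ring R \<Longrightarrow> free_left_module R I (free_module R I)"
  by (intro free_left_module.intro free_left_module_axioms.intro) auto

lemma free_left_module_bimod_power:
  "ring R \<Longrightarrow> free_left_module R {..<N} (bimod_power N (ring_bimod R (\<lambda>r. r) \<beta>))"
  by (intro free_left_module.intro free_left_module_axioms.intro)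
    (auto simp: bimod_power_def free_module_def ring_bimod_def)

text \<open>The data of the dual basis lemma, in finite form. The vectors are a family over
  \<open>J\<close> and not a set, since images of different unit vectors of a power may
  coincide.\<close>

definition dual_basis ::
  "('r, 'a) ring_scheme \<Rightarrow> ('r, 'm, 'e) module_scheme \<Rightarrow> 'j set \<Rightarrow> ('j \<Rightarrow> 'm \<Rightarrow> 'r) \<Rightarrow> ('j \<Rightarrow> 'm) \<Rightarrow> bool"
  where
  "dual_basis R M J \<phi> b \<longleftrightarrow>
     finite J \<and> b \<in> J \<rightarrow> carrier M \<and>
     (\<forall>k\<in>J. \<phi> k \<in> left_mod_hom R M (ring_bimod R (\<lambda>r. r) (\<lambda>r. r))) \<and>
     (\<forall>m\<in>carrier M. m = (\<Oplus>\<^bsub>M\<^esub>k\<in>J. \<phi> k m \<odot>\<^bsub>M\<^esub> b k))"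

context left_module
begin

text \<open>The free module in \<open>projective_module\<close> has its basis in the element type of
  \<open>M\<close>, so the vectors must become their own indices. Functionals that belong to the
  same vector are added up.\<close>

lemma dual_basis_image:
  assumes "dual_basis R M J \<phi> b"
  obtains \<psi> where "dual_basis R M (b ` J) \<psi> (\<lambda>x. x)"
proof
  have fin: "finite J" and b: "b \<in> J \<rightarrow> carrier M"
    and \<phi>: "\<And>k. k \<in> J \<Longrightarrow> \<phi> k \<in> left_mod_hom R M (ring_bimod R (\<lambda>r. r) (\<lambda>r. r))"
    and exp: "\<And>m. m \<in> carrier M \<Longrightarrow> m = (\<Oplus>\<^bsub>M\<^esub>k\<in>J. \<phi> k m \<odot>\<^bsub>M\<^esub> b k)"
    using assms by (auto simp: dual_basis_def)
  define \<psi> where "\<psi> x m = (\<Oplus>\<^bsub>R\<^esub>k\<in>{k \<in> J. b k = x}. \<phi> k m)" for x m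
  have c: "\<phi> k m \<in> carrier R" if "k \<in> J" "m \<in> carrier M" for k m
    using add_hom_closed[OF left_mod_hom_add_hom[OF \<phi>]] that by simp
  have hom: "\<psi> x \<in> left_mod_hom R M (ring_bimod R (\<lambda>r. r) (\<lambda>r. r))" for x
  proof (intro left_mod_homI add_homI)
    fix m m' assume m: "m \<in> carrier M" "m' \<in> carrier M"
    have "\<psi> x (m \<oplus>\<^bsub>M\<^esub> m') = (\<Oplus>\<^bsub>R\<^esub>k\<in>{k \<in> J. b k = x}. \<phi> k m \<oplus>\<^bsub>R\<^esub> \<phi> k m')"
      unfolding \<psi>_def using m c
      by (intro R.finsum_cong') (auto simp: add_hom_add[OF left_mod_hom_add_hom[OF \<phi>]])
    then show "\<psi> x (m \<oplus>\<^bsub>M\<^esub> m') = \<psi> x m \<oplus>\<^bsub>ring_bimod R (\<lambda>r. r) (\<lambda>r. r)\<^esub> \<psi> x m'"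
      unfolding \<psi>_def using m c by (simp add: R.finsum_addf Pi_iff)
  next
    fix r m assume m: "r \<in> carrier R" "m \<in> carrier M"
    have "\<psi> x (r \<odot>\<^bsub>M\<^esub> m) = (\<Oplus>\<^bsub>R\<^esub>k\<in>{k \<in> J. b k = x}. r \<otimes>\<^bsub>R\<^esub> \<phi> k m)"
      unfolding \<psi>_def using m c
      by (intro R.finsum_cong') (auto simp: left_mod_hom_smult[OF \<phi>])
    also have "\<dots> = r \<otimes>\<^bsub>R\<^esub> \<psi> x m"
      unfolding \<psi>_def using m c fin by (intro R.finsum_rdistr[symmetric]) auto
    finally show "\<psi> x (r \<odot>\<^bsub>M\<^esub> m) = r \<odot>\<^bsub>ring_bimod R (\<lambda>r. r) (\<lambda>r. r)\<^esub> \<psi> x m"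
      by simp
  qed (use c in \<open>auto simp: \<psi>_def intro!: R.finsum_closed\<close>)
  have "m = (\<Oplus>\<^bsub>M\<^esub>x\<in>b ` J. \<psi> x m \<odot>\<^bsub>M\<^esub> x)" if m: "m \<in> carrier M" for m
  proof -
    \<comment> \<open>The sum is sorted by the fibres of \<open>b\<close>. On a fibre the vector is
      constant, and its coefficients add up to \<open>\<psi> x m\<close>.\<close>
    have J: "J = (\<Union>x\<in>b ` J. {k \<in> J. b k = x})"
      by auto
    have "m = (\<Oplus>\<^bsub>M\<^esub>k\<in>(\<Union>x\<in>b ` J. {k \<in> J. b k = x}). \<phi> k m \<odot>\<^bsub>M\<^esub> b k)"
      using exp[OF m] J by simp
    also have "\<dots> = (\<Oplus>\<^bsub>M\<^esub>x\<in>b ` J. \<Oplus>\<^bsub>M\<^esub>k\<in>{k \<in> J. b k = x}. \<phi> k m \<odot>\<^bsub>M\<^esub> b k)"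
      using fin b c m
      by (intro M.add.finprod_UN_disjoint) (auto simp: pairwise_def disjnt_def Pi_iff)
    also have "\<dots> = (\<Oplus>\<^bsub>M\<^esub>x\<in>b ` J. \<psi> x m \<odot>\<^bsub>M\<^esub> x)"
    proof (rule M.finsum_cong'[OF refl])
      fix x assume "x \<in> b ` J"
      then have x: "x \<in> carrier M" using b by auto
      have "\<psi> x m \<odot>\<^bsub>M\<^esub> x = (\<Oplus>\<^bsub>M\<^esub>k\<in>{k \<in> J. b k = x}. \<phi> k m \<odot>\<^bsub>M\<^esub> x)"
        unfolding \<psi>_def using c m
        by (intro add_hom_finsum[OF R.abelian_group_axioms M.abelian_group_axioms smult_add_hom_left[OF x]])
          auto
      also have "\<dots> = (\<Oplus>\<^bsub>M\<^esub>k\<in>{k \<in> J. b k = x}. \<phi> k m \<odot>\<^bsub>M\<^esub> b k)"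
        using c m x by (intro M.finsum_cong') auto
      finally show "(\<Oplus>\<^bsub>M\<^esub>k\<in>{k \<in> J. b k = x}. \<phi> k m \<odot>\<^bsub>M\<^esub> b k) = \<psi> x m \<odot>\<^bsub>M\<^esub> x"
        by simp
    qed (use hom add_hom_closed[OF left_mod_hom_add_hom[OF hom]] b m in \<open>auto simp: Pi_iff\<close>)
    finally show ?thesis .
  qed
  with fin b hom show "dual_basis R M (b ` J) \<psi> (\<lambda>x. x)"
    by (auto simp: dual_basis_def)
qed

text \<open>For finite \<open>X\<close> this is the map out of the free module that sends the unit
  vectors to the \<open>b x\<close>. It is the retraction needed below, both onto a projective
  module and from a power of \<open>A\<close> onto \<open>Q\<close>.\<close>

lemma linear_combination_hom:
  assumes "free_left_module R X F" "b \<in> X \<rightarrow> carrier M"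
  shows "(\<lambda>v. \<Oplus>\<^bsub>M\<^esub>x\<in>X. v x \<odot>\<^bsub>M\<^esub> b x) \<in> left_mod_hom R F M"
proof (intro left_mod_homI add_homI)
  interpret F: free_left_module R X F by fact
  have at: "v x \<in> carrier R" "b x \<in> carrier M" if "v \<in> carrier F" "x \<in> X" for v x
    using that assms(2) by (auto simp: F.free_simps)
  fix v assume v: "v \<in> carrier F"
  then show "(\<Oplus>\<^bsub>M\<^esub>x\<in>X. v x \<odot>\<^bsub>M\<^esub> b x) \<in> carrier M"
    using at by (auto intro!: M.finsum_closed)
  show "(\<Oplus>\<^bsub>M\<^esub>x\<in>X. (v \<oplus>\<^bsub>F\<^esub> w) x \<odot>\<^bsub>M\<^esub> b x)
      = (\<Oplus>\<^bsub>M\<^esub>x\<in>X. v x \<odot>\<^bsub>M\<^esub> b x) \<oplus>\<^bsub>M\<^esub> (\<Oplus>\<^bsub>M\<^esub>x\<in>X. w x \<odot>\<^bsub>M\<^esub> b x)"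
    if w: "w \<in> carrier F" for w
  proof -
    have "(\<Oplus>\<^bsub>M\<^esub>x\<in>X. (v \<oplus>\<^bsub>F\<^esub> w) x \<odot>\<^bsub>M\<^esub> b x)
        = (\<Oplus>\<^bsub>M\<^esub>x\<in>X. v x \<odot>\<^bsub>M\<^esub> b x \<oplus>\<^bsub>M\<^esub> w x \<odot>\<^bsub>M\<^esub> b x)"
      using at v w by (intro M.finsum_cong') (auto simp: F.free_at smult_l_distr)
    also have "\<dots> = (\<Oplus>\<^bsub>M\<^esub>x\<in>X. v x \<odot>\<^bsub>M\<^esub> b x) \<oplus>\<^bsub>M\<^esub> (\<Oplus>\<^bsub>M\<^esub>x\<in>X. w x \<odot>\<^bsub>M\<^esub> b x)"
      using at v w by (intro M.finsum_addf) auto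
    finally show ?thesis .
  qed
  show "(\<Oplus>\<^bsub>M\<^esub>x\<in>X. (r \<odot>\<^bsub>F\<^esub> v) x \<odot>\<^bsub>M\<^esub> b x) = r \<odot>\<^bsub>M\<^esub> (\<Oplus>\<^bsub>M\<^esub>x\<in>X. v x \<odot>\<^bsub>M\<^esub> b x)"
    if r: "r \<in> carrier R" for r
  proof -
    have "r \<odot>\<^bsub>M\<^esub> (\<Oplus>\<^bsub>M\<^esub>x\<in>X. v x \<odot>\<^bsub>M\<^esub> b x) = (\<Oplus>\<^bsub>M\<^esub>x\<in>X. r \<odot>\<^bsub>M\<^esub> (v x \<odot>\<^bsub>M\<^esub> b x))"
      using at v
      by (intro add_hom_finsum[OF M.abelian_group_axioms M.abelian_group_axioms smult_add_hom[OF r]])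
        auto
    also have "\<dots> = (\<Oplus>\<^bsub>M\<^esub>x\<in>X. (r \<odot>\<^bsub>F\<^esub> v) x \<odot>\<^bsub>M\<^esub> b x)"
      using at v r by (intro M.finsum_cong') (auto simp: F.free_at smult_assoc)
    finally show ?thesis by simp
  qed
qed

text \<open>The expansion formula says that taking coordinates and then forming the linear
  combination is the identity, so the coordinate map embeds \<open>M\<close> as a direct summand of
  a free module of finite rank.\<close>

lemma dual_basis_imp_finitely_generated_projective:
  assumes "dual_basis R M J \<phi> b"
  shows "finitely_generated_module R M" "projective_module R M"
proof -
  obtain \<psi> where \<psi>: "dual_basis R M (b ` J) \<psi> (\<lambda>x. x)"
    using dual_basis_image[OF assms] .
  define X where "X = b ` J"
  have fin: "finite X" and X: "X \<subseteq> carrier M"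
    and hom: "\<And>x. x \<in> X \<Longrightarrow> \<psi> x \<in> left_mod_hom R M (ring_bimod R (\<lambda>r. r) (\<lambda>r. r))"
    and exp: "\<And>m. m \<in> carrier M \<Longrightarrow> m = (\<Oplus>\<^bsub>M\<^esub>x\<in>X. \<psi> x m \<odot>\<^bsub>M\<^esub> x)"
    using \<psi> by (auto simp: dual_basis_def X_def)
  have c: "\<psi> x m \<in> carrier R" if "x \<in> X" "m \<in> carrier M" for x m
    using add_hom_closed[OF left_mod_hom_add_hom[OF hom]] that by simp
  have "\<exists>r\<in>X \<rightarrow> carrier R. m = (\<Oplus>\<^bsub>M\<^esub>x\<in>X. r x \<odot>\<^bsub>M\<^esub> x)" if "m \<in> carrier M" for m
    using exp[OF that] c that by (intro bexI[of _ "\<lambda>x. \<psi> x m"]) auto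
  then show "finitely_generated_module R M"
    using fin X by (auto simp: finitely_generated_module_def)
  interpret F: free_left_module R X "free_module R X"
    by (rule free_left_module_free_module) (rule R.ring_axioms)
  define i where "i m = (\<lambda>x\<in>X. \<psi> x m)" for m
  define p where "p v = (\<Oplus>\<^bsub>M\<^esub>x\<in>X. v x \<odot>\<^bsub>M\<^esub> x)" for v
  have "i \<in> left_mod_hom R M (free_module R X)"
    using fin c by (intro left_mod_homI add_homI)
      (auto simp: i_def F.free_simps left_mod_hom_smult[OF hom]
        add_hom_add[OF left_mod_hom_add_hom[OF hom]] intro!: restrict_ext)
  moreover have "p \<in> left_mod_hom R (free_module R X) M"
    unfolding p_def using fin X
    by (intro linear_combination_hom free_left_module_free_module R.ring_axioms) auto
  moreover have "p (i m) = m" if m: "m \<in> carrier M" for m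
  proof -
    have "p (i m) = (\<Oplus>\<^bsub>M\<^esub>x\<in>X. \<psi> x m \<odot>\<^bsub>M\<^esub> x)"
      unfolding p_def i_def using c m X by (intro M.finsum_cong') auto
    then show ?thesis
      using exp[OF m] by simp
  qed
  ultimately show "projective_module R M"
    using retract_direct_summand[OF F.left_module_axioms] unfolding projective_module_def by blast
qed

text \<open>The ambient free module may have infinite rank. But each of the finitely many generators
  has finite support in it, and outside the union \<open>J\<close> of these supports every element
  of \<open>M\<close> has zero coordinates. The coordinates in \<open>J\<close>, together with the
  retracted unit vectors, form the dual basis.\<close>

lemma finitely_generated_projective_imp_dual_basis:
  assumes "finitely_generated_module R M" "projective_module R M"
  obtains J :: "'m set" and \<phi> b where "dual_basis R M J \<phi> b"
proof -
  obtain X where fin: "finite X" and X: "X \<subseteq> carrier M"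
    and gen: "\<And>m. m \<in> carrier M \<Longrightarrow> \<exists>r\<in>X \<rightarrow> carrier R. m = (\<Oplus>\<^bsub>M\<^esub>x\<in>X. r x \<odot>\<^bsub>M\<^esub> x)"
    using assms(1) unfolding finitely_generated_module_def by blast
  obtain I :: "'m set" and D h where D: "direct_summand R D (free_module R I)"
    and h: "h \<in> left_mod_iso R M (free_module R I\<lparr>carrier := D\<rparr>)"
    using assms(2) unfolding projective_module_def by blast
  interpret F: free_left_module R I "free_module R I"
    by (rule free_left_module_free_module) (rule R.ring_axioms)
  obtain p where h: "h \<in> left_mod_hom R M (free_module R I)"
    and p: "p \<in> left_mod_hom R (free_module R I) M"
    and ph: "\<And>m. m \<in> carrier M \<Longrightarrow> p (h m) = m"
    using direct_summand_retraction[OF F.left_module_axioms D h] by blast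
  define J where "J = (\<Union>x\<in>X. {i \<in> I. h x i \<noteq> \<zero>\<^bsub>R\<^esub>})"
  have hc: "h m \<in> carrier (free_module R I)" if "m \<in> carrier M" for m
    using add_hom_closed[OF left_mod_hom_add_hom[OF h] that] .
  have J: "finite J" "J \<subseteq> I"
    using fin X hc by (auto simp: J_def F.free_simps)
  have \<phi>: "(\<lambda>m. h m i) \<in> left_mod_hom R M (ring_bimod R (\<lambda>r. r) (\<lambda>r. r))" if "i \<in> I" for i
    using left_mod_hom_comp[OF h F.eval_hom[OF that]] .
  \<comment> \<open>The i-th coordinate is a linear functional that vanishes on all generators,
    hence on \<open>M\<close>.\<close>
  have vanish: "h m i = \<zero>\<^bsub>R\<^esub>" if m: "m \<in> carrier M" and i: "i \<in> I - J" for m i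
  proof -
    obtain r where r: "r \<in> X \<rightarrow> carrier R" and m': "m = (\<Oplus>\<^bsub>M\<^esub>x\<in>X. r x \<odot>\<^bsub>M\<^esub> x)"
      using gen[OF m] by blast
    have ev: "(\<lambda>m. h m i) \<in> add_hom M R"
      using left_mod_hom_add_hom[OF \<phi>, of i] i by (simp add: add_hom_def)
    have "h m i = (\<Oplus>\<^bsub>R\<^esub>x\<in>X. h (r x \<odot>\<^bsub>M\<^esub> x) i)"
      unfolding m' using r X
      by (intro add_hom_finsum[OF M.abelian_group_axioms R.abelian_group_axioms ev])
        (auto simp: Pi_iff subset_iff)
    also have "\<dots> = (\<Oplus>\<^bsub>R\<^esub>x\<in>X. \<zero>\<^bsub>R\<^esub>)"
    proof (rule R.finsum_cong'[OF refl])
      fix x assume x: "x \<in> X"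
      then have "h x i = \<zero>\<^bsub>R\<^esub>" using i by (auto simp: J_def)
      then show "h (r x \<odot>\<^bsub>M\<^esub> x) i = \<zero>\<^bsub>R\<^esub>"
        using left_mod_hom_smult[OF \<phi>, of i "r x" x] i x r X by auto
    qed auto
    finally show ?thesis by simp
  qed
  have "dual_basis R M J (\<lambda>k m. h m k) (\<lambda>k. p (F.unit_vec k))"
    unfolding dual_basis_def
  proof (intro conjI ballI)
    show "(\<lambda>k. p (F.unit_vec k)) \<in> J \<rightarrow> carrier M"
      using add_hom_closed[OF left_mod_hom_add_hom[OF p]] F.unit_vec_closed by auto
    fix m assume m: "m \<in> carrier M"
    let ?F = "free_module R I"
    have at: "h m k \<in> carrier R" if "k \<in> J" for k
      using hc[OF m] that J by (auto simp: F.free_simps)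
    have "h m = (\<Oplus>\<^bsub>?F\<^esub>k\<in>J. h m k \<odot>\<^bsub>?F\<^esub> F.unit_vec k)"
      using m J by (intro F.unit_vec_expansion hc vanish)
    then have "m = p (\<Oplus>\<^bsub>?F\<^esub>k\<in>J. h m k \<odot>\<^bsub>?F\<^esub> F.unit_vec k)"
      using ph[OF m] by simp
    also have "\<dots> = (\<Oplus>\<^bsub>M\<^esub>k\<in>J. p (h m k \<odot>\<^bsub>?F\<^esub> F.unit_vec k))"
      using at F.unit_vec_closed
      by (intro add_hom_finsum[OF F.M.abelian_group_axioms M.abelian_group_axioms
            left_mod_hom_add_hom[OF p]]) auto
    also have "\<dots> = (\<Oplus>\<^bsub>M\<^esub>k\<in>J. h m k \<odot>\<^bsub>M\<^esub> p (F.unit_vec k))"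
      using at F.unit_vec_closed add_hom_closed[OF left_mod_hom_add_hom[OF p]]
      by (intro M.finsum_cong') (auto simp: left_mod_hom_smult[OF p])
    finally show "m = (\<Oplus>\<^bsub>M\<^esub>k\<in>J. h m k \<odot>\<^bsub>M\<^esub> p (F.unit_vec k))" .
  qed (use J \<phi> in auto)
  then show thesis by (rule that)
qed

end

section \<open>Tensor products\<close>

text \<open>The defining relations of a tensor product are differences; these equivalences translate
  them into equations and back.\<close>

lemma
  fixes G (structure)
  assumes "abelian_group G" "x \<in> carrier G" "y \<in> carrier G"
  shows diff_eq_zero_iff: "x \<ominus> y = \<zero> \<longleftrightarrow> x = y"
    and diff_eq_iff: "z \<in> carrier G \<Longrightarrow> x \<ominus> y = z \<longleftrightarrow> x = y \<oplus> z"
proof -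
  interpret abelian_group G by fact
  show "x \<ominus> y = \<zero> \<longleftrightarrow> x = y"
    using assms(2,3) minus_equality[of x "\<ominus> y"] by (auto simp: minus_eq r_neg)
  show "x \<ominus> y = z \<longleftrightarrow> x = y \<oplus> z" if "z \<in> carrier G"
    using assms(2,3) that add.inv_solve_right[of z x y] by (auto simp: minus_eq a_comm)
qed

definition simple_tensor ::
  "('s, 'a) ring_scheme \<Rightarrow> ('r, 's, 'm) bimod \<Rightarrow> ('s, 'n, 'e) module_scheme \<Rightarrow> 'm \<Rightarrow> 'n
    \<Rightarrow> ('m \<times> 'n \<Rightarrow>\<^sub>0 int) set"
  where
  "simple_tensor S M N x y =
     tensor_null S M N #>\<^bsub>free_Abelian_group (carrier M \<times> carrier N)\<^esub> frag_of (x, y)"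

text \<open>
  \<open>T\<close> is any additive structure on the cosets; its further fields are left open in order to cover
  \<^const>\<open>tensor_bimod\<close> and \<^const>\<open>tensor_bimod_left_factor\<close> at once.
\<close>

locale tensor_product = M: abelian_group M + N: abelian_group N
  for S :: "('s, 'a) ring_scheme" and M :: "('r, 's, 'm) bimod" and N :: "('s, 'n, 'e) module_scheme"
    and T :: "(('m \<times> 'n \<Rightarrow>\<^sub>0 int) set, 'x) ring_scheme" +
  assumes right_closed: "\<lbrakk>x \<in> carrier M; s \<in> carrier S\<rbrakk> \<Longrightarrow> rsmult M x s \<in> carrier M"
    and left_closed: "\<lbrakk>s \<in> carrier S; y \<in> carrier N\<rbrakk> \<Longrightarrow> s \<odot>\<^bsub>N\<^esub> y \<in> carrier N"
    and carrier_T: "carrier T = carrier (tensor_group S M N)"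
    and zero_T: "\<zero>\<^bsub>T\<^esub> = \<one>\<^bsub>tensor_group S M N\<^esub>"
    and add_T: "add T = monoid.mult (tensor_group S M N)"
begin

abbreviation "free_grp \<equiv> free_Abelian_group (carrier M \<times> carrier N)"
abbreviation "cls z \<equiv> tensor_null S M N #>\<^bsub>free_grp\<^esub> z"
abbreviation "tens \<equiv> simple_tensor S M N"

lemma tensor_rels_subset: "tensor_rels S M N \<subseteq> carrier free_grp"
  by (auto simp: tensor_rels_def right_closed left_closed simp del: frag_of_in_free_Abelian_group
      dest!: subsetD[OF keys_diff])

lemma subgroup_tensor_null: "subgroup (tensor_null S M N) free_grp"
  unfolding tensor_null_def
  by (rule group.generate_is_subgroup[OF group_free_Abelian_group tensor_rels_subset])

lemma normal_tensor_null: "tensor_null S M N \<lhd> free_grp"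
  by (rule comm_group.subgroup_imp_normal[OF abelian_free_Abelian_group subgroup_tensor_null])

lemma carrier_T_eq: "carrier T = cls ` carrier free_grp"
  by (simp add: carrier_T tensor_group_def carrier_FactGroup)

lemma abelian_group_T: "abelian_group T"
proof -
  interpret TG: comm_group "tensor_group S M N"
    unfolding tensor_group_def
    by (rule comm_group.abelian_FactGroup[OF abelian_free_Abelian_group subgroup_tensor_null])
  show ?thesis
    by (rule abelian_groupI)
      (simp_all add: carrier_T zero_T add_T TG.m_ac TG.l_inv_ex del: mult_FactGroup)
qed

sublocale T: abelian_group T
  by (rule abelian_group_T)

lemma cls_closed: "z \<in> carrier free_grp \<Longrightarrow> cls z \<in> carrier T"
  unfolding carrier_T_eq by (rule imageI)

lemma cls_add:
  "\<lbrakk>w \<in> carrier free_grp; z \<in> carrier free_grp\<rbrakk> \<Longrightarrow> cls (w + z) = cls w \<oplus>\<^bsub>T\<^esub> cls z"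
  using normal.rcos_sum[OF normal_tensor_null, of w z] by (simp add: add_T tensor_group_def)

lemma cls_null: "z \<in> tensor_null S M N \<Longrightarrow> cls z = \<zero>\<^bsub>T\<^esub>"
  using group.coset_join2[OF group_free_Abelian_group _ subgroup_tensor_null]
    subgroup.subset[OF subgroup_tensor_null]
  by (auto simp: zero_T tensor_group_def)

lemma cls_zero: "cls 0 = \<zero>\<^bsub>T\<^esub>"
  using cls_null subgroup.one_closed[OF subgroup_tensor_null] by simp

lemma cls_minus: "z \<in> carrier free_grp \<Longrightarrow> cls (- z) = \<ominus>\<^bsub>T\<^esub> cls z"
  using cls_add[of "- z" z] cls_closed[of z] cls_closed[of "- z"] cls_zero
  by (intro T.minus_equality[symmetric]) auto

lemma cls_diff:
  "\<lbrakk>w \<in> carrier free_grp; z \<in> carrier free_grp\<rbrakk> \<Longrightarrow> cls (w - z) = cls w \<ominus>\<^bsub>T\<^esub> cls z"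
  using cls_add[of w "- z"] cls_minus[of z] by (simp add: T.minus_eq)

lemma tens_closed [simp]: "\<lbrakk>x \<in> carrier M; y \<in> carrier N\<rbrakk> \<Longrightarrow> tens x y \<in> carrier T"
  unfolding simple_tensor_def by (rule cls_closed) simp

lemma cls_rels: "z \<in> tensor_rels S M N \<Longrightarrow> cls z = \<zero>\<^bsub>T\<^esub>"
  by (rule cls_null) (auto simp: tensor_null_def intro: generate.incl)

lemma frag_diff_closed:
  assumes "w \<in> carrier free_grp" "z \<in> carrier free_grp"
  shows "w - z \<in> carrier free_grp"
  using assms keys_diff[of w z] by auto

lemma tens_add_left:
  assumes "x \<in> carrier M" "x' \<in> carrier M" "y \<in> carrier N"
  shows "tens (x \<oplus>\<^bsub>M\<^esub> x') y = tens x y \<oplus>\<^bsub>T\<^esub> tens x' y"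
proof -
  have "frag_of (x \<oplus>\<^bsub>M\<^esub> x', y) - frag_of (x, y) - frag_of (x', y) \<in> tensor_rels S M N"
    using assms unfolding tensor_rels_def by blast
  from cls_rels[OF this] have "(tens (x \<oplus>\<^bsub>M\<^esub> x') y \<ominus>\<^bsub>T\<^esub> tens x y) \<ominus>\<^bsub>T\<^esub> tens x' y = \<zero>\<^bsub>T\<^esub>"
    using assms by (simp add: cls_diff frag_diff_closed simple_tensor_def
        del: carrier_free_Abelian_group_iff)
  then show ?thesis
    using assms by (simp add: diff_eq_zero_iff[OF T.abelian_group_axioms]
        diff_eq_iff[OF T.abelian_group_axioms])
qed

lemma tens_add_right:
  assumes "x \<in> carrier M" "y \<in> carrier N" "y' \<in> carrier N"
  shows "tens x (y \<oplus>\<^bsub>N\<^esub> y') = tens x y \<oplus>\<^bsub>T\<^esub> tens x y'"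
proof -
  have "frag_of (x, y \<oplus>\<^bsub>N\<^esub> y') - frag_of (x, y) - frag_of (x, y') \<in> tensor_rels S M N"
    using assms unfolding tensor_rels_def by blast
  from cls_rels[OF this] have "(tens x (y \<oplus>\<^bsub>N\<^esub> y') \<ominus>\<^bsub>T\<^esub> tens x y) \<ominus>\<^bsub>T\<^esub> tens x y' = \<zero>\<^bsub>T\<^esub>"
    using assms by (simp add: cls_diff frag_diff_closed simple_tensor_def
        del: carrier_free_Abelian_group_iff)
  then show ?thesis
    using assms by (simp add: diff_eq_zero_iff[OF T.abelian_group_axioms]
        diff_eq_iff[OF T.abelian_group_axioms])
qed

lemma tens_balanced:
  assumes "x \<in> carrier M" "s \<in> carrier S" "y \<in> carrier N"
  shows "tens (rsmult M x s) y = tens x (s \<odot>\<^bsub>N\<^esub> y)"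
proof -
  have "frag_of (rsmult M x s, y) - frag_of (x, s \<odot>\<^bsub>N\<^esub> y) \<in> tensor_rels S M N"
    using assms unfolding tensor_rels_def by blast
  from cls_rels[OF this] have "tens (rsmult M x s) y \<ominus>\<^bsub>T\<^esub> tens x (s \<odot>\<^bsub>N\<^esub> y) = \<zero>\<^bsub>T\<^esub>"
    using assms right_closed left_closed
    by (simp add: cls_diff simple_tensor_def del: carrier_free_Abelian_group_iff)
  then show ?thesis
    using assms right_closed left_closed by (simp add: diff_eq_zero_iff[OF T.abelian_group_axioms])
qed

section \<open>Maps out of a tensor product\<close>

lemma tens_add_hom_right: "x \<in> carrier M \<Longrightarrow> tens x \<in> add_hom N T"
  by (rule add_homI) (auto simp: tens_add_right)

text \<open>The cosets of the free generators are the simple tensors, and they generate the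
  quotient. From here on, identities of additive maps are checked on simple tensors instead of on
  representatives.\<close>

lemma tensor_hom_ext:
  assumes "abelian_group H" "u \<in> add_hom T H" "v \<in> add_hom T H"
    and uv: "\<And>x y. \<lbrakk>x \<in> carrier M; y \<in> carrier N\<rbrakk> \<Longrightarrow> u (tens x y) = v (tens x y)"
    and "t \<in> carrier T"
  shows "u t = v t"
proof -
  interpret H: abelian_group H by fact
  note u = add_hom_add[OF assms(2)] add_hom_zero[OF T.abelian_group_axioms assms(1,2)]
    add_hom_a_inv[OF T.abelian_group_axioms assms(1,2)]
  note v = add_hom_add[OF assms(3)] add_hom_zero[OF T.abelian_group_axioms assms(1,3)]
    add_hom_a_inv[OF T.abelian_group_axioms assms(1,3)]
  obtain z where z: "Poly_Mapping.keys z \<subseteq> carrier M \<times> carrier N" "t = cls z"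
    using assms(5) by (auto simp: carrier_T_eq)
  from z(1) have "u (cls z) = v (cls z)"
  proof (induction z rule: free_Abelian_group_induct[consumes 1, case_names zero diff of])
    case zero
    then show ?case by (simp add: cls_zero u v)
  next
    case (diff x y)
    then have "cls (x - y) = cls x \<ominus>\<^bsub>T\<^esub> cls y" "cls x \<in> carrier T" "cls y \<in> carrier T"
      by (simp_all add: cls_diff cls_closed)
    then show ?case
      using diff by (simp add: T.minus_eq u v)
  next
    case (of a)
    then show ?case
      using uv by (auto simp: simple_tensor_def)
  qed
  with z show ?thesis by simp
qed

text \<open>\<open>\<beta>\<close> extends to the free abelian group on pairs. Additivity in each
  argument and balancedness say precisely that the three kinds of relations go to zero, so the
  extension factors through the quotient.\<close>

lemma tensor_universal:
  assumes "abelian_group H"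
    and \<beta>: "\<And>x y. \<lbrakk>x \<in> carrier M; y \<in> carrier N\<rbrakk> \<Longrightarrow> \<beta> x y \<in> carrier H"
    and left: "\<And>x x' y. \<lbrakk>x \<in> carrier M; x' \<in> carrier M; y \<in> carrier N\<rbrakk> \<Longrightarrow>
      \<beta> (x \<oplus>\<^bsub>M\<^esub> x') y = \<beta> x y \<oplus>\<^bsub>H\<^esub> \<beta> x' y"
    and right: "\<And>x y y'. \<lbrakk>x \<in> carrier M; y \<in> carrier N; y' \<in> carrier N\<rbrakk> \<Longrightarrow>
      \<beta> x (y \<oplus>\<^bsub>N\<^esub> y') = \<beta> x y \<oplus>\<^bsub>H\<^esub> \<beta> x y'"
    and balanced: "\<And>x s y. \<lbrakk>x \<in> carrier M; s \<in> carrier S; y \<in> carrier N\<rbrakk> \<Longrightarrow>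
      \<beta> (rsmult M x s) y = \<beta> x (s \<odot>\<^bsub>N\<^esub> y)"
  obtains u where "u \<in> add_hom T H"
    "\<And>x y. \<lbrakk>x \<in> carrier M; y \<in> carrier N\<rbrakk> \<Longrightarrow> u (tens x y) = \<beta> x y"
proof -
  interpret H: abelian_group H by fact
  have "case_prod \<beta> ` (carrier M \<times> carrier N) \<subseteq> carrier (add_monoid H)"
    using \<beta> by auto
  then obtain h where h: "h \<in> hom free_grp (add_monoid H)"
    and h_of: "\<And>x. x \<in> carrier M \<times> carrier N \<Longrightarrow> h (frag_of x) = case_prod \<beta> x"
    using comm_group.free_Abelian_group_universal[OF H.a_comm_group] by meson
  interpret h: group_hom free_grp "add_monoid H" h
    by (intro group_hom.intro group_hom_axioms.intro group_free_Abelian_group H.a_group h)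
  have h_diff: "h (w - z) = h w \<ominus>\<^bsub>H\<^esub> h z" if "w \<in> carrier free_grp" "z \<in> carrier free_grp" for w z
  proof -
    have "h (w + (- z)) = h w \<oplus>\<^bsub>H\<^esub> h (- z)"
      using h.hom_mult[of w "- z"] that by simp
    moreover have "h (- z) = \<ominus>\<^bsub>H\<^esub> h z"
      using h.hom_inv[of z] that by (simp add: a_inv_def)
    ultimately show ?thesis by (simp add: H.minus_eq)
  qed
  have "tensor_rels S M N \<subseteq> kernel free_grp (add_monoid H) h"
  proof
    fix z assume z: "z \<in> tensor_rels S M N"
    then have "h z = \<zero>\<^bsub>H\<^esub>"
      unfolding tensor_rels_def
      by (elim UnE CollectE exE conjE)
        (simp_all add: h_diff frag_diff_closed h_of \<beta> left right balanced right_closed left_closed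
          diff_eq_zero_iff[OF assms(1)] diff_eq_iff[OF assms(1)] del: carrier_free_Abelian_group_iff)
    then show "z \<in> kernel free_grp (add_monoid H) h"
      using z tensor_rels_subset
      by (auto simp: kernel_def simp del: carrier_free_Abelian_group_iff)
  qed
  then have "tensor_null S M N \<subseteq> kernel free_grp (add_monoid H) h"
    unfolding tensor_null_def
    by (intro group.generate_subgroup_incl[OF group_free_Abelian_group] h.subgroup_kernel)
  then obtain u where u: "u \<in> hom (free_grp Mod tensor_null S M N) (add_monoid H)"
    "\<And>z. z \<in> carrier free_grp \<Longrightarrow> u (cls z) = h z"
    using h.FactGroup_universal_kernel[OF normal_tensor_null] by blast
  show thesis
  proof
    show "u \<in> add_hom T H"
      using u(1) by (auto simp: add_hom_def hom_def carrier_T add_T tensor_group_def)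
    show "u (tens x y) = \<beta> x y" if "x \<in> carrier M" "y \<in> carrier N" for x y
      using u(2)[of "frag_of (x, y)"] h_of[of "(x, y)"] that by (simp add: simple_tensor_def)
  qed
qed

text \<open>\<open>tensor_map\<close> is written with \<open>the_elem\<close> over all
  representatives of a coset, so it is meaningful only if they all give the same coset. This is
  shown by comparison with the map \<open>u\<close> that the universal property provides.\<close>

lemma
  assumes \<phi>: "\<phi> \<in> add_hom M M" and \<psi>: "\<psi> \<in> add_hom N N"
    and \<phi>_s: "\<And>x s. \<lbrakk>x \<in> carrier M; s \<in> carrier S\<rbrakk> \<Longrightarrow> \<phi> (rsmult M x s) = rsmult M (\<phi> x) s"
    and \<psi>_s: "\<And>s y. \<lbrakk>s \<in> carrier S; y \<in> carrier N\<rbrakk> \<Longrightarrow> \<psi> (s \<odot>\<^bsub>N\<^esub> y) = s \<odot>\<^bsub>N\<^esub> \<psi> y"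
  shows tensor_map_hom: "tensor_map S M N \<phi> \<psi> \<in> add_hom T T"
    and tensor_map_tens: "\<lbrakk>x \<in> carrier M; y \<in> carrier N\<rbrakk> \<Longrightarrow>
      tensor_map S M N \<phi> \<psi> (tens x y) = tens (\<phi> x) (\<psi> y)"
proof -
  note \<phi>' = add_hom_closed[OF \<phi>] and \<psi>' = add_hom_closed[OF \<psi>]
  obtain u where u: "u \<in> add_hom T T"
    and u_tens: "\<And>x y. \<lbrakk>x \<in> carrier M; y \<in> carrier N\<rbrakk> \<Longrightarrow> u (tens x y) = tens (\<phi> x) (\<psi> y)"
    by (rule tensor_universal[OF T.abelian_group_axioms, of "\<lambda>x y. tens (\<phi> x) (\<psi> y)"])
      (auto simp: \<phi>' \<psi>' add_hom_add[OF \<phi>] add_hom_add[OF \<psi>] tens_add_left tens_add_right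
        \<phi>_s \<psi>_s tens_balanced)
  define e where "e = frag_extend (\<lambda>(x, y). frag_of (\<phi> x, \<psi> y))"
  note u' = add_hom_add[OF u] add_hom_zero[OF T.abelian_group_axioms T.abelian_group_axioms u]
    add_hom_a_inv[OF T.abelian_group_axioms T.abelian_group_axioms u]
  \<comment> \<open>On representatives \<open>e\<close> computes \<open>u\<close>. As
    \<open>u\<close> sees only the coset of z, the set under \<open>the_elem\<close> turns out to be
    \<open>{u t}\<close>.\<close>
  have e: "e z \<in> carrier free_grp \<and> cls (e z) = u (cls z)"
    if "Poly_Mapping.keys z \<subseteq> carrier M \<times> carrier N" for z
    using that
  proof (induction z rule: free_Abelian_group_induct[consumes 1, case_names zero diff of])
    case zero
    then show ?case by (simp add: e_def cls_zero u')
  next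
    case (diff x y)
    then have "cls (x - y) = cls x \<ominus>\<^bsub>T\<^esub> cls y" "cls x \<in> carrier T" "cls y \<in> carrier T"
      by (simp_all add: cls_diff cls_closed)
    moreover have "e (x - y) = e x - e y"
      by (simp add: e_def frag_extend_diff)
    moreover have "e x - e y \<in> carrier free_grp" "cls (e x - e y) = cls (e x) \<ominus>\<^bsub>T\<^esub> cls (e y)"
      using diff by (simp_all add: cls_diff frag_diff_closed del: carrier_free_Abelian_group_iff)
    ultimately show ?case
      using diff by (simp add: T.minus_eq u' del: carrier_free_Abelian_group_iff)
  next
    case (of a)
    then show ?case
      using u_tens \<phi>' \<psi>' by (auto simp: simple_tensor_def e_def)
  qed
  have map: "tensor_map S M N \<phi> \<psi> t = u t" if t: "t \<in> carrier T" for t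
  proof -
    obtain z where z: "z \<in> carrier free_grp" "t = cls z"
      using t by (auto simp: carrier_T_eq)
    have "cls (e w) = u t" if w: "w \<in> t" for w
    proof -
      have "w \<in> carrier free_grp"
        using w z monoid.r_coset_subset_G[OF group.is_monoid[OF group_free_Abelian_group]]
          subgroup.subset[OF subgroup_tensor_null] by blast
      moreover have "cls w = t"
        using group.repr_independence[OF group_free_Abelian_group _ z(1) subgroup_tensor_null] w z(2)
        by simp
      ultimately show ?thesis
        using e by auto
    qed
    moreover have "z \<in> t"
      using group.rcos_self[OF group_free_Abelian_group z(1) subgroup_tensor_null] z(2) by simp
    ultimately have "(\<lambda>z. cls (e z)) ` t = {u t}"
      by auto
    then show ?thesis
      by (simp add: tensor_map_def e_def)
  qed
  show "tensor_map S M N \<phi> \<psi> \<in> add_hom T T"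
    using u by (auto simp: add_hom_def map Pi_iff)
  show "tensor_map S M N \<phi> \<psi> (tens x y) = tens (\<phi> x) (\<psi> y)" if "x \<in> carrier M" "y \<in> carrier N"
    using that by (simp add: map u_tens)
qed

end

section \<open>The bimodule structure on a tensor product\<close>

lemma tensor_product_tensor_bimod:
  assumes "bimodule R S M" "bimodule S S' N"
  shows "tensor_product S M N (tensor_bimod S M N)"
proof -
  interpret M: bimodule R S M by fact
  interpret N: bimodule S S' N by fact
  show ?thesis
    by unfold_locales (auto simp: tensor_bimod_def)
qed

text \<open>With the scalars fixed, both sides of each remaining axiom are additive in the tensor,
  so it suffices to compare them on x \<otimes> y, where the axiom is inherited from
  \<open>M\<close> or \<open>N\<close>.\<close>

lemma bimodule_tensor_bimod:
  assumes "bimodule R S M" "bimodule S S' N"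
  shows "bimodule R S' (tensor_bimod S M N)"
proof -
  interpret M: bimodule R S M by fact
  interpret N: bimodule S S' N by fact
  define T where "T = tensor_bimod S M N"
  interpret T: tensor_product S M N T
    unfolding T_def by (rule tensor_product_tensor_bimod[OF assms])
  have smult_T: "smult T r = tensor_map S M N (\<lambda>x. r \<odot>\<^bsub>M\<^esub> x) (\<lambda>y. y)"
    and rsmult_T: "(\<lambda>t. rsmult T t s) = tensor_map S M N (\<lambda>x. x) (\<lambda>y. rsmult N y s)" for r s
    by (auto simp: T_def tensor_bimod_def)
  note compat = M.smult_add_hom N.rsmult_add_hom add_hom_id M.smult_rsmult N.smult_rsmult
  have l: "smult T r \<in> add_hom T T" if "r \<in> carrier R" for r
    unfolding smult_T using that by (intro T.tensor_map_hom) (simp_all add: compat)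
  have l_tens: "r \<odot>\<^bsub>T\<^esub> T.tens x y = T.tens (r \<odot>\<^bsub>M\<^esub> x) y"
    if "r \<in> carrier R" "x \<in> carrier M" "y \<in> carrier N" for r x y
    unfolding smult_T using that by (intro T.tensor_map_tens) (simp_all add: compat)
  have r: "(\<lambda>t. rsmult T t s) \<in> add_hom T T" if "s \<in> carrier S'" for s
    unfolding rsmult_T using that by (intro T.tensor_map_hom) (simp_all add: compat)
  have r_tens: "rsmult T (T.tens x y) s = T.tens x (rsmult N y s)"
    if "s \<in> carrier S'" "x \<in> carrier M" "y \<in> carrier N" for s x y
    unfolding fun_cong[OF rsmult_T] using that by (intro T.tensor_map_tens) (simp_all add: compat)
  \<comment> \<open>This covers the right-hand sides of the two laws that distribute over a sum of
    scalars.\<close>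
  have sum: "(\<lambda>t. u t \<oplus>\<^bsub>T\<^esub> v t) \<in> add_hom T T" if "u \<in> add_hom T T" "v \<in> add_hom T T" for u v
    using that by (auto simp: add_hom_def Pi_iff T.T.a_ac)
  note ext = T.tensor_hom_ext[OF T.T.abelian_group_axioms]
  have "bimodule R S' T"
  proof (intro bimodule.intro left_module.intro left_module_axioms.intro bimodule_axioms.intro)
    fix r r' x assume *: "r \<in> carrier R" "r' \<in> carrier R" "x \<in> carrier T"
    show "(r \<oplus>\<^bsub>R\<^esub> r') \<odot>\<^bsub>T\<^esub> x = r \<odot>\<^bsub>T\<^esub> x \<oplus>\<^bsub>T\<^esub> r' \<odot>\<^bsub>T\<^esub> x"
      by (rule ext[where t = x])
        (use * in \<open>simp_all add: sum l l_tens M.smult_l_distr T.tens_add_left\<close>)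
    show "(r \<otimes>\<^bsub>R\<^esub> r') \<odot>\<^bsub>T\<^esub> x = r \<odot>\<^bsub>T\<^esub> (r' \<odot>\<^bsub>T\<^esub> x)"
      by (rule ext[where t = x])
        (use * in \<open>simp_all add: add_hom_comp[OF l l] l l_tens M.smult_assoc\<close>)
  next
    fix x assume *: "x \<in> carrier T"
    show "\<one>\<^bsub>R\<^esub> \<odot>\<^bsub>T\<^esub> x = x"
      by (rule ext[where t = x]) (use * in \<open>simp_all add: l l_tens add_hom_id\<close>)
    show "rsmult T x \<one>\<^bsub>S'\<^esub> = x"
      by (rule ext[where t = x]) (use * in \<open>simp_all add: r r_tens add_hom_id\<close>)
  next
    fix x s s' assume *: "x \<in> carrier T" "s \<in> carrier S'" "s' \<in> carrier S'"
    show "rsmult T x (s \<oplus>\<^bsub>S'\<^esub> s') = rsmult T x s \<oplus>\<^bsub>T\<^esub> rsmult T x s'"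
      by (rule ext[where t = x])
        (use * in \<open>simp_all add: sum r r_tens N.rsmult_r_distr T.tens_add_right\<close>)
    show "rsmult T x (s \<otimes>\<^bsub>S'\<^esub> s') = rsmult T (rsmult T x s) s'"
      by (rule ext[where t = x])
        (use * in \<open>simp_all add: add_hom_comp[OF r r] r r_tens N.rsmult_assoc\<close>)
  next
    fix r x s assume *: "r \<in> carrier R" "x \<in> carrier T" "s \<in> carrier S'"
    show "rsmult T (r \<odot>\<^bsub>T\<^esub> x) s = r \<odot>\<^bsub>T\<^esub> rsmult T x s"
      by (rule ext[where t = x])
        (use * in \<open>simp_all add: add_hom_comp[OF l r] add_hom_comp[OF r l] l_tens r_tens\<close>)
  qed (use M.R.ring_axioms N.S.ring_axioms T.T.abelian_group_axioms
      add_hom_add[OF l] add_hom_closed[OF l] add_hom_add[OF r] add_hom_closed[OF r] in auto)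
  then show ?thesis
    by (simp add: T_def)
qed

section \<open>Centralizers in bimodules\<close>

text \<open>Built the same way as \<open>tensor_centralizer\<close>, but for an arbitrary bimodule,
  so that the concrete \<open>P\<close> becomes an instance by unfolding.\<close>

definition bimod_centralizer :: "'c ring \<Rightarrow> ('c \<Rightarrow> 'a) \<Rightarrow> ('a, 'c, 'q) bimod \<Rightarrow> ('a, 'q) module" where
  "bimod_centralizer C h Q =
     module.truncate Q
       \<lparr>carrier := {p \<in> carrier Q. \<forall>c\<in>carrier C. h c \<odot>\<^bsub>Q\<^esub> p = rsmult Q p c}\<rparr>"

locale bimodule_along = bimodule A C Q
  for A :: "'a ring" and C :: "'c ring" and h :: "'c \<Rightarrow> 'a" and Q :: "('a, 'c, 'q) bimod" +
  assumes h_hom: "h \<in> ring_hom C A"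
begin

abbreviation "V \<equiv> centralizer_ring A C h"
abbreviation "P \<equiv> bimod_centralizer C h Q"
abbreviation "A_AC \<equiv> ring_bimod A (\<lambda>a. a) h"
abbreviation "A_AV \<equiv> ring_bimod A (\<lambda>a. a) (\<lambda>v. v)"
abbreviation "VP \<equiv> tensor_bimod_left_factor V A_AV (\<lambda>a c. a \<otimes>\<^bsub>A\<^esub> h c) P"

text \<open>A factorisation of the identity of \<open>Q\<close> through a finite power of
  \<open>A\<close>. The maps back from \<open>A\<close> to \<open>Q\<close> are a \<mapsto> a p_k,
  and \<open>p k \<in> carrier P\<close> encodes that they respect the right action of
  \<open>C\<close>.\<close>

definition bimod_dual_basis :: "'j set \<Rightarrow> ('j \<Rightarrow> 'q \<Rightarrow> 'a) \<Rightarrow> ('j \<Rightarrow> 'q) \<Rightarrow> bool" where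
  "bimod_dual_basis J \<phi> p \<longleftrightarrow>
     finite J \<and> p \<in> J \<rightarrow> carrier P \<and>
     (\<forall>k\<in>J. \<phi> k \<in> bimod_hom A C Q A_AC) \<and>
     (\<forall>q\<in>carrier Q. q = (\<Oplus>\<^bsub>Q\<^esub>k\<in>J. \<phi> k q \<odot>\<^bsub>Q\<^esub> p k))"

lemma h_closed [simp]: "c \<in> carrier C \<Longrightarrow> h c \<in> carrier A"
  using h_hom by (rule ring_hom_closed)

lemma carrier_V: "carrier V = {a \<in> carrier A. \<forall>c\<in>carrier C. a \<otimes>\<^bsub>A\<^esub> h c = h c \<otimes>\<^bsub>A\<^esub> a}"
  by (simp add: centralizer_ring_def)

lemma V_simps [simp]:
  "v \<oplus>\<^bsub>V\<^esub> w = v \<oplus>\<^bsub>A\<^esub> w" "v \<otimes>\<^bsub>V\<^esub> w = v \<otimes>\<^bsub>A\<^esub> w" "\<one>\<^bsub>V\<^esub> = \<one>\<^bsub>A\<^esub>" "\<zero>\<^bsub>V\<^esub> = \<zero>\<^bsub>A\<^esub>"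
  by (simp_all add: centralizer_ring_def)

lemma V_in_A: "v \<in> carrier V \<Longrightarrow> v \<in> carrier A"
  by (simp add: carrier_V)

lemma V_commute: "\<lbrakk>v \<in> carrier V; c \<in> carrier C\<rbrakk> \<Longrightarrow> v \<otimes>\<^bsub>A\<^esub> h c = h c \<otimes>\<^bsub>A\<^esub> v"
  by (simp add: carrier_V)

lemma ring_V: "ring V"
proof -
  have "subring (carrier V) A"
  proof (rule R.subringI)
    show "\<ominus>\<^bsub>A\<^esub> v \<in> carrier V" if "v \<in> carrier V" for v
      using that by (auto simp: carrier_V R.l_minus R.r_minus)
    show "v \<otimes>\<^bsub>A\<^esub> w \<in> carrier V" if "v \<in> carrier V" "w \<in> carrier V" for v w
      using that by (auto simp: carrier_V) (metis R.m_assoc h_closed)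
  qed (auto simp: carrier_V R.l_distr R.r_distr)
  then have "ring (A\<lparr>carrier := carrier V\<rparr>)"
    by (rule R.subring_is_ring)
  then show ?thesis
    by (simp add: centralizer_ring_def)
qed

lemma carrier_P: "carrier P = {p \<in> carrier Q. \<forall>c\<in>carrier C. h c \<odot>\<^bsub>Q\<^esub> p = rsmult Q p c}"
  by (simp add: bimod_centralizer_def)

lemma P_simps [simp]:
  "p \<oplus>\<^bsub>P\<^esub> q = p \<oplus>\<^bsub>Q\<^esub> q" "\<zero>\<^bsub>P\<^esub> = \<zero>\<^bsub>Q\<^esub>" "a \<odot>\<^bsub>P\<^esub> p = a \<odot>\<^bsub>Q\<^esub> p"
  by (simp_all add: bimod_centralizer_def module.defs)

lemma P_in_Q: "p \<in> carrier P \<Longrightarrow> p \<in> carrier Q"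
  by (simp add: carrier_P)

lemma P_commute: "\<lbrakk>p \<in> carrier P; c \<in> carrier C\<rbrakk> \<Longrightarrow> h c \<odot>\<^bsub>Q\<^esub> p = rsmult Q p c"
  by (simp add: carrier_P)

lemma P_smult_closed:
  assumes "v \<in> carrier V" "p \<in> carrier P"
  shows "v \<odot>\<^bsub>Q\<^esub> p \<in> carrier P"
proof -
  have "h c \<odot>\<^bsub>Q\<^esub> (v \<odot>\<^bsub>Q\<^esub> p) = rsmult Q (v \<odot>\<^bsub>Q\<^esub> p) c" if c: "c \<in> carrier C" for c
  proof -
    have "h c \<odot>\<^bsub>Q\<^esub> (v \<odot>\<^bsub>Q\<^esub> p) = (v \<otimes>\<^bsub>A\<^esub> h c) \<odot>\<^bsub>Q\<^esub> p"
      using assms c by (simp add: smult_assoc V_in_A P_in_Q V_commute)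
    also have "\<dots> = rsmult Q (v \<odot>\<^bsub>Q\<^esub> p) c"
      using assms c by (simp add: smult_assoc smult_rsmult V_in_A P_in_Q P_commute)
    finally show ?thesis .
  qed
  then show ?thesis
    using assms by (simp add: carrier_P V_in_A)
qed

lemma left_module_P: "left_module V P"
proof -
  have zero: "\<zero>\<^bsub>Q\<^esub> \<in> carrier P"
    using add_hom_zero[OF M.abelian_group_axioms M.abelian_group_axioms rsmult_add_hom]
    by (auto simp: carrier_P)
  have minus: "\<ominus>\<^bsub>Q\<^esub> p \<in> carrier P" if "p \<in> carrier P" for p
    using that add_hom_a_inv[OF M.abelian_group_axioms M.abelian_group_axioms rsmult_add_hom]
      add_hom_a_inv[OF M.abelian_group_axioms M.abelian_group_axioms smult_add_hom]
    by (auto simp: carrier_P)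
  have "abelian_group P"
  proof (rule abelian_groupI)
    show "p \<oplus>\<^bsub>P\<^esub> q \<in> carrier P" if "p \<in> carrier P" "q \<in> carrier P" for p q
      using that by (auto simp: carrier_P smult_r_distr rsmult_l_distr)
    show "\<exists>q\<in>carrier P. q \<oplus>\<^bsub>P\<^esub> p = \<zero>\<^bsub>P\<^esub>" if "p \<in> carrier P" for p
      using that minus[OF that] by (intro bexI[of _ "\<ominus>\<^bsub>Q\<^esub> p"]) (auto simp: M.l_neg P_in_Q)
  qed (use zero in \<open>auto simp: P_in_Q M.a_ac\<close>)
  then show ?thesis
    using ring_V
    by (intro left_module.intro left_module_axioms.intro)
      (auto simp: P_smult_closed V_in_A P_in_Q smult_l_distr smult_r_distr smult_assoc)
qed

sublocale P: left_module V P
  by (rule left_module_P)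

lemma P_incl: "(\<lambda>p. p) \<in> add_hom P Q"
  by (rule add_homI) (auto simp: P_in_Q)

lemma finsum_P: "f \<in> J \<rightarrow> carrier P \<Longrightarrow> finsum P f J = finsum Q f J"
  by (rule add_hom_finsum[OF P.M.abelian_group_axioms M.abelian_group_axioms P_incl])

section \<open>The tensor product of A and P over V\<close>

lemma tensor_product_VP: "tensor_product V A_AV P VP"
  using abelian_group_ring_bimod[OF R.ring_axioms] P.M.abelian_group_axioms
  by (intro tensor_product.intro tensor_product_axioms.intro)
    (auto simp: V_in_A P_smult_closed tensor_bimod_left_factor_def)

sublocale VP: tensor_product V A_AV P VP
  by (rule tensor_product_VP)

lemma VP_left:
  assumes "a \<in> carrier A"
  shows "smult VP a \<in> add_hom VP VP"
    and "\<lbrakk>x \<in> carrier A; p \<in> carrier P\<rbrakk> \<Longrightarrow> a \<odot>\<^bsub>VP\<^esub> VP.tens x p = VP.tens (a \<otimes>\<^bsub>A\<^esub> x) p"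
proof -
  have *: "smult VP a = tensor_map V A_AV P (\<lambda>x. a \<otimes>\<^bsub>A\<^esub> x) (\<lambda>p. p)"
    by (simp add: tensor_bimod_left_factor_def)
  have l: "(\<lambda>x. a \<otimes>\<^bsub>A\<^esub> x) \<in> add_hom A_AV A_AV"
    using assms by (intro add_homI) (auto simp: R.r_distr)
  show "smult VP a \<in> add_hom VP VP"
    unfolding * using assms
    by (intro VP.tensor_map_hom l add_hom_id) (auto simp: R.m_assoc V_in_A)
  show "a \<odot>\<^bsub>VP\<^esub> VP.tens x p = VP.tens (a \<otimes>\<^bsub>A\<^esub> x) p" if "x \<in> carrier A" "p \<in> carrier P"
    unfolding * using assms that
    by (intro VP.tensor_map_tens l add_hom_id) (auto simp: R.m_assoc V_in_A)
qed

text \<open>The right action of \<open>C\<close> on the first factor is compatible with the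
  relations over \<open>V\<close> because \<open>V\<close> centralizes the image of
  \<open>C\<close>: (x v) h(c) = (x h(c)) v.\<close>

lemma VP_right:
  assumes "c \<in> carrier C"
  shows "(\<lambda>t. rsmult VP t c) \<in> add_hom VP VP"
    and "\<lbrakk>x \<in> carrier A; p \<in> carrier P\<rbrakk> \<Longrightarrow> rsmult VP (VP.tens x p) c = VP.tens (x \<otimes>\<^bsub>A\<^esub> h c) p"
proof -
  have *: "(\<lambda>t. rsmult VP t c) = tensor_map V A_AV P (\<lambda>x. x \<otimes>\<^bsub>A\<^esub> h c) (\<lambda>p. p)"
    by (auto simp: tensor_bimod_left_factor_def)
  have r: "(\<lambda>x. x \<otimes>\<^bsub>A\<^esub> h c) \<in> add_hom A_AV A_AV"
    using assms by (intro add_homI) (auto simp: R.l_distr)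
  show "(\<lambda>t. rsmult VP t c) \<in> add_hom VP VP"
    unfolding * using assms
    by (intro VP.tensor_map_hom r add_hom_id) (auto simp: R.m_assoc V_in_A V_commute)
  show "rsmult VP (VP.tens x p) c = VP.tens (x \<otimes>\<^bsub>A\<^esub> h c) p" if "x \<in> carrier A" "p \<in> carrier P"
    unfolding fun_cong[OF *] using assms that
    by (intro VP.tensor_map_tens r add_hom_id) (auto simp: R.m_assoc V_in_A V_commute)
qed

text \<open>Both actions on \<open>VP\<close> are additive maps known on simple tensors, so
  linearity of an additive \<open>u\<close> can be tested there as well.\<close>

lemma bimod_hom_from_VP:
  assumes "bimodule A C X" "u \<in> add_hom VP X"
    and left: "\<And>a x p. \<lbrakk>a \<in> carrier A; x \<in> carrier A; p \<in> carrier P\<rbrakk> \<Longrightarrow>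
      u (VP.tens (a \<otimes>\<^bsub>A\<^esub> x) p) = a \<odot>\<^bsub>X\<^esub> u (VP.tens x p)"
    and right: "\<And>c x p. \<lbrakk>c \<in> carrier C; x \<in> carrier A; p \<in> carrier P\<rbrakk> \<Longrightarrow>
      u (VP.tens (x \<otimes>\<^bsub>A\<^esub> h c) p) = rsmult X (u (VP.tens x p)) c"
  shows "u \<in> bimod_hom A C VP X"
proof -
  interpret X: bimodule A C X by fact
  note ext = VP.tensor_hom_ext[OF X.M.abelian_group_axioms]
  show ?thesis
  proof (intro bimod_homI left_mod_homI assms(2))
    fix a t assume *: "a \<in> carrier A" "t \<in> carrier VP"
    show "u (a \<odot>\<^bsub>VP\<^esub> t) = a \<odot>\<^bsub>X\<^esub> u t"
      by (rule ext[OF add_hom_comp[OF VP_left(1) assms(2)] add_hom_comp[OF assms(2) X.smult_add_hom]])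
        (use * in \<open>simp_all add: VP_left left\<close>)
  next
    fix t c assume *: "t \<in> carrier VP" "c \<in> carrier C"
    show "u (rsmult VP t c) = rsmult X (u t) c"
      by (rule ext[OF add_hom_comp[OF VP_right(1) assms(2)] add_hom_comp[OF assms(2) X.rsmult_add_hom]])
        (use * in \<open>simp_all add: VP_right right\<close>)
  qed
qed

section \<open>Powers of A and bimodule dual bases\<close>

lemma bimodule_A_AC: "bimodule A C A_AC"
  by (rule bimodule_ring_bimod[OF R.ring_axioms R.ring_axioms S.ring_axioms _ h_hom])
    (simp add: ring_hom_def)

lemma bimod_power_rsmult [simp]:
  "rsmult (bimod_power N A_AC) x c = (\<lambda>k\<in>{..<N}. x k \<otimes>\<^bsub>A\<^esub> h c)"
  by (simp add: bimod_power_def)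

lemma bimodule_bimod_power: "bimodule A C (bimod_power N A_AC)"
proof -
  interpret F: free_left_module A "{..<N}" "bimod_power N A_AC"
    by (rule free_left_module_bimod_power[OF R.ring_axioms])
  have c: "carrier (bimod_power N A_AC) = {..<N} \<rightarrow>\<^sub>E carrier A"
    by (simp add: bimod_power_def)
  have at: "x k \<in> carrier A" if "x \<in> carrier (bimod_power N A_AC)" "k < N" for x k
    using that by (auto simp: c)
  have closed: "rsmult (bimod_power N A_AC) x s \<in> carrier (bimod_power N A_AC)"
    if "x \<in> carrier (bimod_power N A_AC)" "s \<in> carrier C" for x s
    using that at[OF that(1)] by (simp add: c restrict_PiE_iff)
  have rsmult_at: "rsmult (bimod_power N A_AC) x s k = x k \<otimes>\<^bsub>A\<^esub> h s" if "k < N" for x s k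
    using that by simp
  note simps = closed at rsmult_at F.free_at R.l_distr R.r_distr R.m_assoc
    ring_hom_add[OF h_hom] ring_hom_mult[OF h_hom] ring_hom_one[OF h_hom]
  show ?thesis
    \<comment> \<open>Equations between vectors are reduced to coordinates by
      \<open>free_ext\<close>; goals of any other form skip that rule.\<close>
    by (intro bimodule.intro bimodule_axioms.intro F.left_module_axioms S.ring_axioms closed;
        (rule F.free_ext)?; simp add: simps del: bimod_power_rsmult)
qed

lemma bimod_dual_basis_of_summand:
  assumes "bimod_direct_summand A C D (bimod_power N A_AC)"
    and "j \<in> bimod_iso A C Q (bimod_power N A_AC\<lparr>carrier := D\<rparr>)"
  obtains \<phi> p where "bimod_dual_basis {..<N} \<phi> p"
proof -
  let ?F = "bimod_power N A_AC"
  interpret F: free_left_module A "{..<N}" ?F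
    by (rule free_left_module_bimod_power[OF R.ring_axioms])
  obtain r where j: "j \<in> bimod_hom A C Q ?F" and r: "r \<in> bimod_hom A C ?F Q"
    and rj: "\<And>q. q \<in> carrier Q \<Longrightarrow> r (j q) = q"
    using bimod_direct_summand_retraction[OF bimodule_bimod_power assms] by blast
  note r_closed = add_hom_closed[OF bimod_hom_add_hom[OF r]]
    and r_smult = left_mod_hom_smult[OF bimod_hom_left_mod_hom[OF r]]
  have "bimod_dual_basis {..<N} (\<lambda>k q. j q k) (\<lambda>k. r (F.unit_vec k))"
    unfolding bimod_dual_basis_def
  proof (intro conjI ballI)
    show "(\<lambda>k. r (F.unit_vec k)) \<in> {..<N} \<rightarrow> carrier P"
    proof
      fix k
      have "h c \<odot>\<^bsub>Q\<^esub> r (F.unit_vec k) = rsmult Q (r (F.unit_vec k)) c" if c: "c \<in> carrier C" for c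
      proof -
        \<comment> \<open>The entries are 1 or 0, and multiplying these by \<open>h c\<close> from
          either side gives the same result.\<close>
        have "h c \<odot>\<^bsub>?F\<^esub> F.unit_vec k = rsmult ?F (F.unit_vec k) c"
          using c by (auto simp: F.free_simps F.unit_vec_def)
        then show ?thesis
          using c F.unit_vec_closed r_smult[of "h c" "F.unit_vec k"]
            bimod_hom_rsmult[OF r, of "F.unit_vec k" c] by simp
      qed
      then show "r (F.unit_vec k) \<in> carrier P"
        by (simp add: carrier_P r_closed F.unit_vec_closed)
    qed
    show "(\<lambda>q. j q k) \<in> bimod_hom A C Q A_AC" if "k \<in> {..<N}" for k
      using that bimod_hom_rsmult[OF j]
      by (intro bimod_homI left_mod_hom_comp[OF bimod_hom_left_mod_hom[OF j]] F.eval_hom) auto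
    fix q assume q: "q \<in> carrier Q"
    have jq: "j q \<in> carrier ?F"
      using add_hom_closed[OF bimod_hom_add_hom[OF j] q] .
    then have at: "j q k \<in> carrier A" if "k < N" for k
      using that by (auto simp: F.free_simps)
    \<comment> \<open>The expansion of \<open>j q\<close> in unit vectors, with the retraction
      applied to it.\<close>
    have "q = r (\<Oplus>\<^bsub>?F\<^esub>k\<in>{..<N}. j q k \<odot>\<^bsub>?F\<^esub> F.unit_vec k)"
      using F.unit_vec_expansion[OF jq, of "{..<N}"] rj[OF q] by simp
    also have "\<dots> = (\<Oplus>\<^bsub>Q\<^esub>k\<in>{..<N}. r (j q k \<odot>\<^bsub>?F\<^esub> F.unit_vec k))"
      using at F.unit_vec_closed
      by (intro add_hom_finsum[OF F.M.abelian_group_axioms M.abelian_group_axioms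
            bimod_hom_add_hom[OF r]]) auto
    also have "\<dots> = (\<Oplus>\<^bsub>Q\<^esub>k\<in>{..<N}. j q k \<odot>\<^bsub>Q\<^esub> r (F.unit_vec k))"
      using at F.unit_vec_closed r_closed by (intro M.finsum_cong') (auto simp: r_smult)
    finally show "q = (\<Oplus>\<^bsub>Q\<^esub>k\<in>{..<N}. j q k \<odot>\<^bsub>Q\<^esub> r (F.unit_vec k))" .
  qed simp
  then show thesis by (rule that)
qed

lemma summand_of_bimod_dual_basis:
  assumes "bimod_dual_basis {..<N} \<phi> p"
  obtains D where "bimod_direct_summand A C D (bimod_power N A_AC)"
    "bimod_iso A C Q (bimod_power N A_AC\<lparr>carrier := D\<rparr>) \<noteq> {}"
proof -
  let ?F = "bimod_power N A_AC"
  interpret F: free_left_module A "{..<N}" ?F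
    by (rule free_left_module_bimod_power[OF R.ring_axioms])
  have p: "p \<in> {..<N} \<rightarrow> carrier P"
    and \<phi>: "\<And>k. k < N \<Longrightarrow> \<phi> k \<in> bimod_hom A C Q A_AC"
    and exp: "\<And>q. q \<in> carrier Q \<Longrightarrow> q = (\<Oplus>\<^bsub>Q\<^esub>k\<in>{..<N}. \<phi> k q \<odot>\<^bsub>Q\<^esub> p k)"
    using assms by (auto simp: bimod_dual_basis_def)
  have pQ: "p k \<in> carrier Q" if "k < N" for k
    using p that P_in_Q by auto
  have \<phi>_closed: "\<phi> k q \<in> carrier A" if "k < N" "q \<in> carrier Q" for k q
    using add_hom_closed[OF bimod_hom_add_hom[OF \<phi>]] that by simp
  define i where "i q = (\<lambda>k\<in>{..<N}. \<phi> k q)" for q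
  define r where "r v = (\<Oplus>\<^bsub>Q\<^esub>k\<in>{..<N}. v k \<odot>\<^bsub>Q\<^esub> p k)" for v
  have "i \<in> bimod_hom A C Q ?F"
    using \<phi>_closed
    by (intro bimod_homI left_mod_homI add_homI)
      (auto simp: i_def F.free_simps add_hom_add[OF bimod_hom_add_hom[OF \<phi>]]
        left_mod_hom_smult[OF bimod_hom_left_mod_hom[OF \<phi>]] bimod_hom_rsmult[OF \<phi>]
        intro!: restrict_ext)
  moreover have "r \<in> bimod_hom A C ?F Q"
  proof (rule bimod_homI)
    show "r \<in> left_mod_hom A ?F Q"
      unfolding r_def using pQ by (intro linear_combination_hom F.free_left_module_axioms) auto
    fix v c assume v: "v \<in> carrier ?F" and c: "c \<in> carrier C"
    have at: "v k \<in> carrier A" if "k < N" for k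
      using v that by (auto simp: F.free_simps)
    have "rsmult Q (r v) c = (\<Oplus>\<^bsub>Q\<^esub>k\<in>{..<N}. rsmult Q (v k \<odot>\<^bsub>Q\<^esub> p k) c)"
      unfolding r_def using at pQ
      by (intro add_hom_finsum[OF M.abelian_group_axioms M.abelian_group_axioms rsmult_add_hom[OF c]])
        auto
    also have "\<dots> = r (rsmult ?F v c)"
      unfolding r_def
    proof (rule M.finsum_cong'[OF refl])
      fix k assume k: "k \<in> {..<N}"
      \<comment> \<open>Membership in \<open>P\<close> makes \<open>r\<close> right linear: (v_k
        p_k) c = v_k (h(c) p_k) = (v_k h(c)) p_k.\<close>
      then have "p k \<in> carrier P" using p by auto
      then show "rsmult Q (v k \<odot>\<^bsub>Q\<^esub> p k) c = rsmult ?F v c k \<odot>\<^bsub>Q\<^esub> p k"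
        using k at c by (simp add: smult_rsmult smult_assoc P_in_Q P_commute)
    qed (use at pQ c in auto)
    finally show "r (rsmult ?F v c) = rsmult Q (r v) c" by simp
  qed
  moreover have "r (i q) = q" if q: "q \<in> carrier Q" for q
  proof -
    have "r (i q) = (\<Oplus>\<^bsub>Q\<^esub>k\<in>{..<N}. \<phi> k q \<odot>\<^bsub>Q\<^esub> p k)"
      unfolding r_def i_def using \<phi>_closed pQ q by (intro M.finsum_cong') auto
    then show ?thesis using exp[OF q] by simp
  qed
  ultimately show thesis
    using retract_bimod_direct_summand[OF bimodule_bimod_power] that by blast
qed

text \<open>One superfluous zero vector is added, because \<open>N = 0\<close> is excluded even when \<open>Q = 0\<close>.\<close>

lemma bimod_dual_basis_lessThan:
  assumes "bimod_dual_basis J \<phi> p"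
  obtains \<phi>' p' where "bimod_dual_basis {..<Suc (card J)} \<phi>' p'"
proof -
  have J: "finite J" and p: "p \<in> J \<rightarrow> carrier P"
    and \<phi>: "\<And>k. k \<in> J \<Longrightarrow> \<phi> k \<in> bimod_hom A C Q A_AC"
    and exp: "\<And>q. q \<in> carrier Q \<Longrightarrow> q = (\<Oplus>\<^bsub>Q\<^esub>k\<in>J. \<phi> k q \<odot>\<^bsub>Q\<^esub> p k)"
    using assms by (auto simp: bimod_dual_basis_def)
  define n where "n = card J"
  obtain e where e: "bij_betw e {..<n} J"
    using ex_bij_betw_nat_finite[OF J] by (auto simp: n_def atLeast0LessThan)
  then have eJ: "e k \<in> J" if "k < n" for k
    using that by (auto simp: bij_betw_def)
  define \<phi>' where "\<phi>' k = (if k < n then \<phi> (e k) else (\<lambda>_. \<zero>\<^bsub>A\<^esub>))" for k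
  define p' where "p' k = (if k < n then p (e k) else \<zero>\<^bsub>Q\<^esub>)" for k
  have \<phi>_closed: "\<phi> k q \<in> carrier A" if "k \<in> J" "q \<in> carrier Q" for k q
    using add_hom_closed[OF bimod_hom_add_hom[OF \<phi>]] that by simp
  have pQ: "p k \<in> carrier Q" if "k \<in> J" for k
    using p that P_in_Q by auto
  have "bimod_dual_basis {..<Suc n} \<phi>' p'"
    unfolding bimod_dual_basis_def
  proof (intro conjI ballI)
    show "p' \<in> {..<Suc n} \<rightarrow> carrier P"
      using p eJ P.M.zero_closed by (auto simp: p'_def Pi_iff)
    have "(\<lambda>_. \<zero>\<^bsub>A\<^esub>) \<in> bimod_hom A C Q A_AC"
      by (intro bimod_homI left_mod_homI add_homI) auto
    then show "\<phi>' k \<in> bimod_hom A C Q A_AC" for k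
      using \<phi> eJ by (auto simp: \<phi>'_def)
    fix q assume q: "q \<in> carrier Q"
    have "q = (\<Oplus>\<^bsub>Q\<^esub>k\<in>e ` {..<n}. \<phi> k q \<odot>\<^bsub>Q\<^esub> p k)"
      using exp[OF q] e by (simp add: bij_betw_def)
    also have "\<dots> = (\<Oplus>\<^bsub>Q\<^esub>k\<in>{..<n}. \<phi> (e k) q \<odot>\<^bsub>Q\<^esub> p (e k))"
      using e eJ q \<phi>_closed pQ by (intro M.finsum_reindex) (auto simp: bij_betw_def)
    also have "\<dots> = (\<Oplus>\<^bsub>Q\<^esub>k\<in>{..<n}. \<phi>' k q \<odot>\<^bsub>Q\<^esub> p' k)"
      using eJ q \<phi>_closed pQ by (intro M.finsum_cong') (auto simp: \<phi>'_def p'_def)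
    also have "\<dots> = (\<Oplus>\<^bsub>Q\<^esub>k\<in>{..<Suc n}. \<phi>' k q \<odot>\<^bsub>Q\<^esub> p' k)"
      unfolding lessThan_Suc using eJ q \<phi>_closed pQ
      by (subst M.finsum_insert) (auto simp: \<phi>'_def p'_def intro!: M.l_zero[symmetric] M.finsum_closed)
    finally show "q = (\<Oplus>\<^bsub>Q\<^esub>k\<in>{..<Suc n}. \<phi>' k q \<odot>\<^bsub>Q\<^esub> p' k)" .
  qed simp
  then show thesis
    using that by (simp add: n_def)
qed

section \<open>Passage between Q and its centralizer P\<close>

lemma dual_basis_of_bimod_dual_basis:
  assumes "bimod_dual_basis J \<phi> p"
  shows "dual_basis V P J \<phi> p"
proof -
  have J: "finite J" and p: "p \<in> J \<rightarrow> carrier P"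
    and \<phi>: "\<And>k. k \<in> J \<Longrightarrow> \<phi> k \<in> bimod_hom A C Q A_AC"
    and exp: "\<And>q. q \<in> carrier Q \<Longrightarrow> q = (\<Oplus>\<^bsub>Q\<^esub>k\<in>J. \<phi> k q \<odot>\<^bsub>Q\<^esub> p k)"
    using assms by (auto simp: bimod_dual_basis_def)
  note \<phi>_closed = add_hom_closed[OF bimod_hom_add_hom[OF \<phi>]]
    and \<phi>_add = add_hom_add[OF bimod_hom_add_hom[OF \<phi>]]
    and \<phi>_smult = left_mod_hom_smult[OF bimod_hom_left_mod_hom[OF \<phi>]]
  have \<phi>V: "\<phi> k q \<in> carrier V" if k: "k \<in> J" and q: "q \<in> carrier P" for k q
  proof -
    \<comment> \<open>Both sides are values of \<open>\<phi> k\<close> at one element, since q c =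
      h(c) q for q in \<open>P\<close>: right linearity gives the left side, left linearity the
      right side.\<close>
    have "\<phi> k q \<otimes>\<^bsub>A\<^esub> h c = h c \<otimes>\<^bsub>A\<^esub> \<phi> k q" if c: "c \<in> carrier C" for c
      using bimod_hom_rsmult[OF \<phi>[OF k] P_in_Q[OF q] c] \<phi>_smult[OF k, of "h c" q] c
        P_in_Q[OF q] P_commute[OF q c] by simp
    then show ?thesis
      using \<phi>_closed[OF k P_in_Q[OF q]] by (simp add: carrier_V)
  qed
  show ?thesis
    unfolding dual_basis_def
  proof (intro conjI ballI)
    show "\<phi> k \<in> left_mod_hom V P (ring_bimod V (\<lambda>r. r) (\<lambda>r. r))" if "k \<in> J" for k
      using that \<phi>V
      by (intro left_mod_homI add_homI) (auto simp: \<phi>_add \<phi>_smult P_in_Q V_in_A)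
    fix m assume m: "m \<in> carrier P"
    \<comment> \<open>The terms lie in \<open>P\<close>, so the sum formed in \<open>P\<close>
      agrees with the sum in \<open>Q\<close>, where the expansion is known.\<close>
    have "(\<Oplus>\<^bsub>P\<^esub>k\<in>J. \<phi> k m \<odot>\<^bsub>P\<^esub> p k) = (\<Oplus>\<^bsub>Q\<^esub>k\<in>J. \<phi> k m \<odot>\<^bsub>P\<^esub> p k)"
      using p m \<phi>V P_smult_closed by (intro finsum_P) (auto simp: Pi_iff)
    then show "m = (\<Oplus>\<^bsub>P\<^esub>k\<in>J. \<phi> k m \<odot>\<^bsub>P\<^esub> p k)"
      using exp[OF P_in_Q[OF m]] by simp
  qed (use J p in auto)
qed

text \<open>The multiplication \<open>a \<otimes> p \<mapsto> a p\<close> has the inverse \<open>q \<mapsto> \<Sum>\<^sub>k \<phi>\<^sub>k q \<otimes> p\<^sub>k\<close>.\<close>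

lemma tensor_iso_of_bimod_dual_basis:
  assumes "bimod_dual_basis J \<phi> p"
  shows "bimod_iso A C VP Q \<noteq> {}"
proof -
  have J: "finite J" and p: "p \<in> J \<rightarrow> carrier P"
    and \<phi>: "\<And>k. k \<in> J \<Longrightarrow> \<phi> k \<in> bimod_hom A C Q A_AC"
    and exp: "\<And>q. q \<in> carrier Q \<Longrightarrow> q = (\<Oplus>\<^bsub>Q\<^esub>k\<in>J. \<phi> k q \<odot>\<^bsub>Q\<^esub> p k)"
    using assms by (auto simp: bimod_dual_basis_def)
  have pP: "p k \<in> carrier P" if "k \<in> J" for k
    using p that by auto
  have \<phi>_closed: "\<phi> k q \<in> carrier A" if "k \<in> J" "q \<in> carrier Q" for k q
    using add_hom_closed[OF bimod_hom_add_hom[OF \<phi>]] that by simp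
  have "dual_basis V P J \<phi> p"
    by (rule dual_basis_of_bimod_dual_basis[OF assms])
  then have \<phi>V: "\<phi> k m \<in> carrier V" if "k \<in> J" "m \<in> carrier P" for k m
    using that add_hom_closed[OF left_mod_hom_add_hom] unfolding dual_basis_def
    by fastforce
  have expP: "m = (\<Oplus>\<^bsub>P\<^esub>k\<in>J. \<phi> k m \<odot>\<^bsub>P\<^esub> p k)" if "m \<in> carrier P" for m
    using \<open>dual_basis V P J \<phi> p\<close> that unfolding dual_basis_def by blast
  obtain \<mu> where \<mu>: "\<mu> \<in> add_hom VP Q"
    and \<mu>_tens: "\<And>a m. \<lbrakk>a \<in> carrier A; m \<in> carrier P\<rbrakk> \<Longrightarrow> \<mu> (VP.tens a m) = a \<odot>\<^bsub>Q\<^esub> m"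
    by (rule VP.tensor_universal[OF M.abelian_group_axioms, of "\<lambda>a m. a \<odot>\<^bsub>Q\<^esub> m"])
      (auto simp: P_in_Q V_in_A smult_l_distr smult_r_distr smult_assoc)
  have \<mu>_hom: "\<mu> \<in> bimod_hom A C VP Q"
    by (rule bimod_hom_from_VP[OF bimodule_axioms \<mu>])
      (simp_all add: \<mu>_tens smult_assoc smult_rsmult P_in_Q P_commute)
  define \<nu> where "\<nu> q = (\<Oplus>\<^bsub>VP\<^esub>k\<in>J. VP.tens (\<phi> k q) (p k))" for q
  have tens_closed: "VP.tens (\<phi> k q) (p k) \<in> carrier VP" if "k \<in> J" "q \<in> carrier Q" for k q
    using that \<phi>_closed pP by simp
  have \<nu>: "\<nu> \<in> add_hom Q VP"
  proof (rule add_homI)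
    show "\<nu> q \<in> carrier VP" if "q \<in> carrier Q" for q
      using that tens_closed by (auto simp: \<nu>_def intro!: VP.T.finsum_closed)
    fix q q' assume q: "q \<in> carrier Q" "q' \<in> carrier Q"
    have "\<nu> (q \<oplus>\<^bsub>Q\<^esub> q') = (\<Oplus>\<^bsub>VP\<^esub>k\<in>J. VP.tens (\<phi> k q) (p k) \<oplus>\<^bsub>VP\<^esub> VP.tens (\<phi> k q') (p k))"
      unfolding \<nu>_def
    proof (rule VP.T.finsum_cong'[OF refl])
      fix k assume k: "k \<in> J"
      show "VP.tens (\<phi> k (q \<oplus>\<^bsub>Q\<^esub> q')) (p k) = VP.tens (\<phi> k q) (p k) \<oplus>\<^bsub>VP\<^esub> VP.tens (\<phi> k q') (p k)"
        using VP.tens_add_left[of "\<phi> k q" "\<phi> k q'" "p k"] k q \<phi>_closed pP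
          add_hom_add[OF bimod_hom_add_hom[OF \<phi>[OF k]] q] by simp
    qed (use q tens_closed in auto)
    also have "\<dots> = \<nu> q \<oplus>\<^bsub>VP\<^esub> \<nu> q'"
      unfolding \<nu>_def using q tens_closed by (intro VP.T.finsum_addf) auto
    finally show "\<nu> (q \<oplus>\<^bsub>Q\<^esub> q') = \<nu> q \<oplus>\<^bsub>VP\<^esub> \<nu> q'" .
  qed
  have \<mu>\<nu>: "\<mu> (\<nu> q) = q" if q: "q \<in> carrier Q" for q
  proof -
    have "\<mu> (\<nu> q) = (\<Oplus>\<^bsub>Q\<^esub>k\<in>J. \<mu> (VP.tens (\<phi> k q) (p k)))"
      unfolding \<nu>_def using q tens_closed
      by (intro add_hom_finsum[OF VP.T.abelian_group_axioms M.abelian_group_axioms \<mu>]) auto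
    also have "\<dots> = (\<Oplus>\<^bsub>Q\<^esub>k\<in>J. \<phi> k q \<odot>\<^bsub>Q\<^esub> p k)"
      using q \<phi>_closed pP by (intro M.finsum_cong') (auto simp: \<mu>_tens P_in_Q)
    finally show ?thesis using exp[OF q] by simp
  qed
  have \<nu>\<mu>: "\<nu> (\<mu> t) = t" if "t \<in> carrier VP" for t
  proof (rule VP.tensor_hom_ext[OF VP.T.abelian_group_axioms add_hom_comp[OF \<mu> \<nu>] add_hom_id _ that])
    fix a m assume a: "a \<in> carrier A_AV" and m: "m \<in> carrier P"
    have "\<nu> (\<mu> (VP.tens a m)) = (\<Oplus>\<^bsub>VP\<^esub>k\<in>J. VP.tens (\<phi> k (a \<odot>\<^bsub>Q\<^esub> m)) (p k))"
      using a m by (simp add: \<mu>_tens \<nu>_def)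
    \<comment> \<open>As m lies in \<open>P\<close>, the coefficient \<open>\<phi> k m\<close> lies
      in \<open>V\<close> and may cross the tensor sign. For a general q in \<open>Q\<close> it
      would only be an element of \<open>A\<close>, which is why the check runs over simple
      tensors.\<close>
    also have "\<dots> = (\<Oplus>\<^bsub>VP\<^esub>k\<in>J. VP.tens a (\<phi> k m \<odot>\<^bsub>P\<^esub> p k))"
    proof (rule VP.T.finsum_cong'[OF refl])
      fix k assume k: "k \<in> J"
      have "\<phi> k (a \<odot>\<^bsub>Q\<^esub> m) = a \<otimes>\<^bsub>A\<^esub> \<phi> k m"
        using left_mod_hom_smult[OF bimod_hom_left_mod_hom[OF \<phi>[OF k]]] a m by (simp add: P_in_Q)
      then show "VP.tens (\<phi> k (a \<odot>\<^bsub>Q\<^esub> m)) (p k) = VP.tens a (\<phi> k m \<odot>\<^bsub>P\<^esub> p k)"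
        using VP.tens_balanced[of a "\<phi> k m" "p k"] k a m \<phi>V pP by simp
    qed (use a m \<phi>V pP P_smult_closed in auto)
    also have "\<dots> = VP.tens a (\<Oplus>\<^bsub>P\<^esub>k\<in>J. \<phi> k m \<odot>\<^bsub>P\<^esub> p k)"
      using a m \<phi>V pP P_smult_closed
      by (intro add_hom_finsum[symmetric, OF P.M.abelian_group_axioms VP.T.abelian_group_axioms
            VP.tens_add_hom_right]) auto
    finally show "\<nu> (\<mu> (VP.tens a m)) = VP.tens a m"
      using expP[OF m] by simp
  qed
  have "bij_betw \<mu> (carrier VP) (carrier Q)"
    using \<mu>\<nu> \<nu>\<mu> add_hom_closed[OF \<mu>] add_hom_closed[OF \<nu>]
    by (intro bij_betw_byWitness[of _ \<nu>]) auto
  then show ?thesis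
    using \<mu>_hom bimod_iso_iff by blast
qed

text \<open>The maps a \<otimes> m \<mapsto> a \<phi>_k(m) together with the elements 1 \<otimes>
  b_k expand every element of \<open>VP\<close>. As \<open>\<theta>\<close> is just some
  isomorphism, both are transported: the vectors by \<open>\<theta>\<close>, the functionals by its
  inverse.\<close>

lemma bimod_dual_basis_of_tensor_iso:
  assumes "dual_basis V P J \<phi> b" "\<theta> \<in> bimod_iso A C VP Q"
  obtains \<psi> p where "bimod_dual_basis J \<psi> p"
proof -
  have J: "finite J" and b: "b \<in> J \<rightarrow> carrier P"
    and \<phi>: "\<And>k. k \<in> J \<Longrightarrow> \<phi> k \<in> left_mod_hom V P (ring_bimod V (\<lambda>r. r) (\<lambda>r. r))"
    and exp: "\<And>m. m \<in> carrier P \<Longrightarrow> m = (\<Oplus>\<^bsub>P\<^esub>k\<in>J. \<phi> k m \<odot>\<^bsub>P\<^esub> b k)"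
    using assms(1) unfolding dual_basis_def by blast+
  have \<theta>: "\<theta> \<in> bimod_hom A C VP Q" "bij_betw \<theta> (carrier VP) (carrier Q)"
    using assms(2) by (simp_all add: bimod_iso_iff)
  have bP: "b k \<in> carrier P" if "k \<in> J" for k
    using b that by auto
  have \<phi>V: "\<phi> k m \<in> carrier V" if "k \<in> J" "m \<in> carrier P" for k m
    using add_hom_closed[OF left_mod_hom_add_hom[OF \<phi>]] that by simp
  note \<phi>_add = add_hom_add[OF left_mod_hom_add_hom[OF \<phi>], simplified]
    and \<phi>_smult = left_mod_hom_smult[OF \<phi>, simplified]
  interpret A_AC: bimodule A C A_AC by (rule bimodule_A_AC)
  have "\<exists>u. u \<in> bimod_hom A C VP A_AC \<and>
      (\<forall>a\<in>carrier A. \<forall>m\<in>carrier P. u (VP.tens a m) = a \<otimes>\<^bsub>A\<^esub> \<phi> k m)" if k: "k \<in> J" for k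
  proof -
    obtain u where u: "u \<in> add_hom VP A_AC"
      and u_tens: "\<And>a m. \<lbrakk>a \<in> carrier A; m \<in> carrier P\<rbrakk> \<Longrightarrow> u (VP.tens a m) = a \<otimes>\<^bsub>A\<^esub> \<phi> k m"
      by (rule VP.tensor_universal[OF A_AC.M.abelian_group_axioms, of "\<lambda>a m. a \<otimes>\<^bsub>A\<^esub> \<phi> k m"])
        (use k \<phi>V V_in_A in \<open>auto simp: R.l_distr R.r_distr R.m_assoc \<phi>_add \<phi>_smult\<close>)
    \<comment> \<open>For the action of \<open>C\<close>, a h(c) \<phi>_k(m) = a \<phi>_k(m) h(c)
      because the value \<open>\<phi> k m\<close> lies in \<open>V\<close>.\<close>
    have "u \<in> bimod_hom A C VP A_AC"
      by (rule bimod_hom_from_VP[OF bimodule_A_AC u])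
        (use k \<phi>V V_in_A V_commute in \<open>simp_all add: u_tens R.m_assoc\<close>)
    with u_tens show ?thesis by blast
  qed
  then obtain u where u: "\<And>k. k \<in> J \<Longrightarrow> u k \<in> bimod_hom A C VP A_AC"
    and u_tens: "\<And>k a m. \<lbrakk>k \<in> J; a \<in> carrier A; m \<in> carrier P\<rbrakk> \<Longrightarrow>
      u k (VP.tens a m) = a \<otimes>\<^bsub>A\<^esub> \<phi> k m"
    by metis
  have u_closed: "u k t \<in> carrier A" if "k \<in> J" "t \<in> carrier VP" for k t
    using add_hom_closed[OF bimod_hom_add_hom[OF u]] that by simp
  define p where "p k = \<theta> (VP.tens \<one>\<^bsub>A\<^esub> (b k))" for k
  note \<theta>_smult = left_mod_hom_smult[OF bimod_hom_left_mod_hom[OF \<theta>(1)]]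
    and \<theta>_rsmult = bimod_hom_rsmult[OF \<theta>(1)]
  have pP: "p k \<in> carrier P" if k: "k \<in> J" for k
  proof -
    have "h c \<odot>\<^bsub>Q\<^esub> p k = rsmult Q (p k) c" if c: "c \<in> carrier C" for c
    proof -
      \<comment> \<open>Both sides are h(c) \<otimes> b_k: the two actions meet in the first factor,
        which is 1.\<close>
      have "h c \<odot>\<^bsub>VP\<^esub> VP.tens \<one>\<^bsub>A\<^esub> (b k) = rsmult VP (VP.tens \<one>\<^bsub>A\<^esub> (b k)) c"
        using k c bP by (simp add: VP_left VP_right)
      then show ?thesis
        using \<theta>_smult[of "h c" "VP.tens \<one>\<^bsub>A\<^esub> (b k)"] \<theta>_rsmult[of "VP.tens \<one>\<^bsub>A\<^esub> (b k)" c] k c bP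
        by (simp add: p_def)
    qed
    then show ?thesis
      using k bP add_hom_closed[OF bimod_hom_add_hom[OF \<theta>(1)]] by (simp add: carrier_P p_def)
  qed
  \<comment> \<open>Both sides are additive in t, and on a simple tensor a \<otimes> m is the sum of
    the a \<otimes> \<phi>_k(m) b_k, that is, of the a \<phi>_k(m) (1 \<otimes> b_k).\<close>
  have expand: "\<theta> t = (\<Oplus>\<^bsub>Q\<^esub>k\<in>J. u k t \<odot>\<^bsub>Q\<^esub> p k)" if t: "t \<in> carrier VP" for t
  proof (rule VP.tensor_hom_ext[OF M.abelian_group_axioms bimod_hom_add_hom[OF \<theta>(1)] _ _ t])
    show "(\<lambda>t. \<Oplus>\<^bsub>Q\<^esub>k\<in>J. u k t \<odot>\<^bsub>Q\<^esub> p k) \<in> add_hom VP Q"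
    proof (rule add_homI)
      show "(\<Oplus>\<^bsub>Q\<^esub>k\<in>J. u k t \<odot>\<^bsub>Q\<^esub> p k) \<in> carrier Q" if "t \<in> carrier VP" for t
        using that u_closed pP P_in_Q by (auto intro!: M.finsum_closed)
      fix t t' assume t: "t \<in> carrier VP" "t' \<in> carrier VP"
      have "(\<Oplus>\<^bsub>Q\<^esub>k\<in>J. u k (t \<oplus>\<^bsub>VP\<^esub> t') \<odot>\<^bsub>Q\<^esub> p k)
          = (\<Oplus>\<^bsub>Q\<^esub>k\<in>J. u k t \<odot>\<^bsub>Q\<^esub> p k \<oplus>\<^bsub>Q\<^esub> u k t' \<odot>\<^bsub>Q\<^esub> p k)"
        using t u_closed pP P_in_Q
        by (intro M.finsum_cong') (auto simp: add_hom_add[OF bimod_hom_add_hom[OF u]] smult_l_distr)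
      also have "\<dots> = (\<Oplus>\<^bsub>Q\<^esub>k\<in>J. u k t \<odot>\<^bsub>Q\<^esub> p k) \<oplus>\<^bsub>Q\<^esub> (\<Oplus>\<^bsub>Q\<^esub>k\<in>J. u k t' \<odot>\<^bsub>Q\<^esub> p k)"
        using t u_closed pP P_in_Q by (intro M.finsum_addf) auto
      finally show "(\<Oplus>\<^bsub>Q\<^esub>k\<in>J. u k (t \<oplus>\<^bsub>VP\<^esub> t') \<odot>\<^bsub>Q\<^esub> p k)
          = (\<Oplus>\<^bsub>Q\<^esub>k\<in>J. u k t \<odot>\<^bsub>Q\<^esub> p k) \<oplus>\<^bsub>Q\<^esub> (\<Oplus>\<^bsub>Q\<^esub>k\<in>J. u k t' \<odot>\<^bsub>Q\<^esub> p k)" .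
    qed
    fix a m assume a: "a \<in> carrier A_AV" and m: "m \<in> carrier P"
    have "VP.tens a m = VP.tens a (\<Oplus>\<^bsub>P\<^esub>k\<in>J. \<phi> k m \<odot>\<^bsub>P\<^esub> b k)"
      using exp[OF m] by simp
    also have "\<dots> = (\<Oplus>\<^bsub>VP\<^esub>k\<in>J. VP.tens a (\<phi> k m \<odot>\<^bsub>P\<^esub> b k))"
      using a m \<phi>V bP P_smult_closed
      by (intro add_hom_finsum[OF P.M.abelian_group_axioms VP.T.abelian_group_axioms
            VP.tens_add_hom_right]) auto
    finally have "\<theta> (VP.tens a m) = (\<Oplus>\<^bsub>Q\<^esub>k\<in>J. \<theta> (VP.tens a (\<phi> k m \<odot>\<^bsub>P\<^esub> b k)))"
      using a m \<phi>V bP P_smult_closed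
      by (simp only:) (intro add_hom_finsum[OF VP.T.abelian_group_axioms M.abelian_group_axioms
            bimod_hom_add_hom[OF \<theta>(1)]], auto)
    also have "\<dots> = (\<Oplus>\<^bsub>Q\<^esub>k\<in>J. u k (VP.tens a m) \<odot>\<^bsub>Q\<^esub> p k)"
    proof (rule M.finsum_cong'[OF refl])
      fix k assume k: "k \<in> J"
      have v: "\<phi> k m \<in> carrier V" "\<phi> k m \<in> carrier A"
        using k m \<phi>V V_in_A by auto
      have "VP.tens a (\<phi> k m \<odot>\<^bsub>P\<^esub> b k) = (a \<otimes>\<^bsub>A\<^esub> \<phi> k m) \<odot>\<^bsub>VP\<^esub> VP.tens \<one>\<^bsub>A\<^esub> (b k)"
        using VP.tens_balanced[of a "\<phi> k m" "b k"] k a v bP by (simp add: VP_left)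
      then show "\<theta> (VP.tens a (\<phi> k m \<odot>\<^bsub>P\<^esub> b k)) = u k (VP.tens a m) \<odot>\<^bsub>Q\<^esub> p k"
        using k a m v bP by (simp add: u_tens p_def \<theta>_smult)
    qed (use a m u_closed pP P_in_Q in auto)
    finally show "\<theta> (VP.tens a m) = (\<Oplus>\<^bsub>Q\<^esub>k\<in>J. u k (VP.tens a m) \<odot>\<^bsub>Q\<^esub> p k)" .
  qed
  define \<theta>' where "\<theta>' = inv_into (carrier VP) \<theta>"
  have \<theta>': "\<theta>' q \<in> carrier VP" "\<theta> (\<theta>' q) = q" if "q \<in> carrier Q" for q
    using that \<theta>(2) by (auto simp: \<theta>'_def bij_betw_def inv_into_into f_inv_into_f)
  have \<theta>'_eq: "\<theta>' (\<theta> t) = t" if "t \<in> carrier VP" for t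
    using that \<theta>(2) by (simp add: \<theta>'_def bij_betw_def)
  \<comment> \<open>In each case the expected value is put into \<open>\<theta>'_eq\<close>, and
    \<open>\<theta>\<close> is pushed through it by linearity.\<close>
  have "\<theta>' \<in> bimod_hom A C Q VP"
  proof (intro bimod_homI left_mod_homI add_homI)
    fix q assume q: "q \<in> carrier Q"
    show "\<theta>' (q \<oplus>\<^bsub>Q\<^esub> q') = \<theta>' q \<oplus>\<^bsub>VP\<^esub> \<theta>' q'" if "q' \<in> carrier Q" for q'
      using \<theta>'_eq[of "\<theta>' q \<oplus>\<^bsub>VP\<^esub> \<theta>' q'"] q that
      by (simp add: \<theta>' add_hom_add[OF bimod_hom_add_hom[OF \<theta>(1)]])
    show "\<theta>' (a \<odot>\<^bsub>Q\<^esub> q) = a \<odot>\<^bsub>VP\<^esub> \<theta>' q" if "a \<in> carrier A" for a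
      using \<theta>'_eq[of "a \<odot>\<^bsub>VP\<^esub> \<theta>' q"] q that
      by (simp add: \<theta>' \<theta>_smult add_hom_closed[OF VP_left(1)])
    show "\<theta>' (rsmult Q q c) = rsmult VP (\<theta>' q) c" if "c \<in> carrier C" for c
      using \<theta>'_eq[of "rsmult VP (\<theta>' q) c"] q that
      by (simp add: \<theta>' \<theta>_rsmult add_hom_closed[OF VP_right(1)])
  qed (rule \<theta>')
  then have "bimod_dual_basis J (\<lambda>k q. u k (\<theta>' q)) p"
    unfolding bimod_dual_basis_def
    using J pP expand[OF \<theta>'(1)] \<theta>'(2) by (auto intro: bimod_hom_comp[OF _ u])
  then show thesis by (rule that)
qed

theorem summand_of_power_iff:
  "(\<exists>N>0. \<exists>D. bimod_direct_summand A C D (bimod_power N A_AC)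
        \<and> bimod_iso A C Q (bimod_power N A_AC\<lparr>carrier := D\<rparr>) \<noteq> {})
    \<longleftrightarrow> finitely_generated_module V P \<and> projective_module V P \<and> bimod_iso A C VP Q \<noteq> {}"
  (is "?lhs \<longleftrightarrow> ?rhs")
proof
  assume ?lhs
  then obtain N D j where "bimod_direct_summand A C D (bimod_power N A_AC)"
    and "j \<in> bimod_iso A C Q (bimod_power N A_AC\<lparr>carrier := D\<rparr>)"
    by auto
  then obtain \<phi> p where db: "bimod_dual_basis {..<N} \<phi> p"
    by (rule bimod_dual_basis_of_summand)
  show ?rhs
    using P.dual_basis_imp_finitely_generated_projective[OF dual_basis_of_bimod_dual_basis[OF db]]
      tensor_iso_of_bimod_dual_basis[OF db] by simp
next
  assume rhs: ?rhs
  \<comment> \<open>The indices have the element type of \<open>Q\<close>, because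
    \<open>projective_module\<close> draws its basis from there. They are renumbered by naturals
    before a power of \<open>A\<close> is formed.\<close>
  then obtain J :: "'q set" and \<phi> b where db: "dual_basis V P J \<phi> b"
    using P.finitely_generated_projective_imp_dual_basis by metis
  obtain \<theta> where "\<theta> \<in> bimod_iso A C VP Q"
    using rhs by auto
  from db this obtain \<psi> p where "bimod_dual_basis J \<psi> p"
    by (rule bimod_dual_basis_of_tensor_iso)
  then obtain \<psi>' p' where "bimod_dual_basis {..<Suc (card J)} \<psi>' p'"
    by (rule bimod_dual_basis_lessThan)
  then obtain D where "bimod_direct_summand A C D (bimod_power (Suc (card J)) A_AC)"
    "bimod_iso A C Q (bimod_power (Suc (card J)) A_AC\<lparr>carrier := D\<rparr>) \<noteq> {}"
    by (rule summand_of_bimod_dual_basis)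
  then show ?lhs
    by (intro exI[of _ "Suc (card J)"]) auto
qed

end

section \<open>The tower of rings\<close>

theorem theorem4p6:
  fixes A :: "'a ring" and B :: "'b ring" and C :: "'c ring"
    and f :: "'b \<Rightarrow> 'a" and g :: "'c \<Rightarrow> 'b"
  assumes "ring_tower A B C f g"
  shows "right_depth_three A B C f g \<longleftrightarrow>
    finitely_generated_module (centralizer_ring A C (f \<circ> g)) (tensor_centralizer A B C f g)
    \<and> projective_module (centralizer_ring A C (f \<circ> g)) (tensor_centralizer A B C f g)
    \<and> bimod_iso A C (tensor_VP A B C f g) (tensor_AA A B f g) \<noteq> {}"
proof -
  have rings: "ring A" "ring B" "ring C" and f: "f \<in> ring_hom B A" and g: "g \<in> ring_hom C B"
    using assms by (auto simp: ring_tower_def)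
  have fg: "f \<circ> g \<in> ring_hom C A"
    using f g by (rule ring_hom_trans[rotated])
  have id: "(\<lambda>a. a) \<in> ring_hom A A"
    by (simp add: ring_hom_def)
  have "bimodule A C (tensor_AA A B f g)"
    unfolding tensor_AA_def using rings f fg id
    by (intro bimodule_tensor_bimod bimodule_ring_bimod)
  then interpret bimodule_along A C "f \<circ> g" "tensor_AA A B f g"
    by (intro bimodule_along.intro bimodule_along_axioms.intro fg)
  \<comment> \<open>With h = \<open>f \<circ> g\<close> and Q = \<open>tensor_AA A B f g\<close> the
    two descriptions coincide, so the equivalence for general bimodules applies verbatim.\<close>
  have P_eq: "tensor_centralizer A B C f g = P"
    by (simp add: tensor_centralizer_def bimod_centralizer_def)
  have "tensor_VP A B C f g = VP"
    by (simp add: tensor_VP_def P_eq)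
  then show ?thesis
    using summand_of_power_iff by (simp add: right_depth_three_def P_eq)
qed

end
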